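(* Let $(X,d,m)$ be a homogeneous ultrametric measure space, $L$ a homogeneous hierarchical Laplacian on it, $\mathcal{H}$ a horocycle, $\sigma:\mathcal{H}\to\mathbb{R}$ a function, $V=\sum_{B\in\mathcal{H}}\sigma(B)1_B$, and $H=L+V$. Choose a point $a_B\in B$ in each $B\in\mathcal{H}$ and let $(X',d',m')$ be the discrete ultrametric measure space $X'=\{a_B:B\in\mathcal{H}\}$ with $d'=d|_{X'\times X'}$ and $m'(\{a_B\})=m(B)$. Then the operator $L_+$ can be identified with a hierarchical Laplacian $L'$ acting on $(X',d',m')$, and respectively $H_+$ can be identified with the Schrödinger type operator $H'=L'+V'$ with potential $V'=\sum_{a\in X'}V(a)\delta_a$. That is, there is a hierarchical Laplacian $L'$ on $(X',d',m')$ such that the unitary operator $U:\mathcal{L}_+\to L^2(X',m')$, $Uf=f|_{X'}$, satisfies $UL_+U^{-1}=L'$ and $UH_+U^{-1}=L'+V'$.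
   Context: Homogeneous ultrametric measure space: $(X,d)$ is a non-compact ultrametric space ($d(x,y)\le\max\{d(x,z),d(z,y)\}$) in which every closed ball $B_r(x)=\{y:d(x,y)\le r\}$ is compact and whose isometry group acts transitively; $m$ is a Radon measure on $X$ with full support, invariant under all isometries, normalized so that $m(B)=\mathrm{diam}(B)$ for every ball $B$ of positive diameter. $\mathcal{B}$ is the family of all distinct balls $B_r(x)$ with $r>0$, and $\mathcal{B}(x)$ the family of those containing $x$. $\mathcal{D}$ is the set of locally constant functions with compact support. Hierarchical Laplacian: let $C:\mathcal{B}\to(0,\infty)$ satisfy $\lambda(B):=\sum_{T\in\mathcal{B},\,B\subseteq T}C(T)<\infty$ for all $B$. For $f\in\mathcal{D}$, $$Lf(x)=\sum_{B\in\mathcal{B}(x)}C(B)\Big(f(x)-\frac1{m(B)}\int_B f\,dm\Big).$$ It is homogeneous if moreover $C(A)=C(B)$ whenever $A,B$ have the same diameter. A hierarchical Laplacian $L'$ on $(X',d',m')$ is defined by the same formula with the balls of $X'$, the measure $m'$ and a function $C'>0$ on the balls of $X'$. All operators $L$, $H=L+V$, $L'$, $L'+V'$ are essentially self-adjoint on the respective spaces of compactly supported locally constant functions, and the same letters denote the closures. A horocycle $\mathcal{H}\subset\mathcal{B}$ is the family of all balls of $\mathcal{B}$ having one fixed common diameter; it is a partition of $X$. $\mathcal{L}_+$ is the closed linear span in $L^2(X,m)$ of $\{1_B:B\in\mathcal{H}\}$, i.e. the $L^2$ functions constant on each $B\in\mathcal{H}$; it is invariant for $L$ and $H$, and $L_+$,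 $H_+$ are the restrictions of $L$, $H$ to $\mathcal{L}_+$. $V'$ acts as multiplication by the function $a\mapsto V(a)$ on $X'$. *)

theory Defs
  imports "HOL-Analysis.Analysis"
begin

text \<open>
  An ultrametric measure space is represented by a measure \<open>m\<close> over a metric space type: its
  points are \<open>space m\<close> and its distance is \<open>dist\<close> restricted to \<open>space m\<close>. A space and a subset
  of it with the induced distance are thus treated alike. Functions on the space are
  represented by elements of \<open>extensional (space m)\<close>; for a space that is a whole type this
  is no restriction. Scalars are complex.
\<close>

definition balls :: "'a::metric_space set \<Rightarrow> 'a set set" where
  "balls S = {cball x r \<inter> S | x r. x \<in> S \<and> r > 0}"

definition isometry_group :: "('a::metric_space \<Rightarrow> 'a) set" where
  "isometry_group = {g. bij g \<and> (\<forall>x y. dist (g x) (g y) = dist x y)}"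

definition radon_measure :: "'a::topological_space measure \<Rightarrow> bool" where
  "radon_measure m \<longleftrightarrow>
     sets m = sets borel \<and>
     (\<forall>K. compact K \<longrightarrow> emeasure m K < \<infinity>) \<and>
     (\<forall>A \<in> sets borel. emeasure m A = (INF U \<in> {U. open U \<and> A \<subseteq> U}. emeasure m U)) \<and>
     (\<forall>U. open U \<longrightarrow> emeasure m U = (SUP K \<in> {K. compact K \<and> K \<subseteq> U}. emeasure m K))"

locale homogeneous_ultrametric_measure_space =
  fixes m :: "'a::metric_space measure"
  assumes ultrametric: "dist (x::'a) y \<le> max (dist x z) (dist z y)"
    and noncompact: "\<not> compact (UNIV :: 'a set)"
    and compact_balls: "compact (cball (x::'a) r)"
    and transitive: "\<exists>g \<in> isometry_group. g (x::'a) = y"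
    and radon: "radon_measure m"
    and full_support: "open U \<Longrightarrow> U \<noteq> {} \<Longrightarrow> emeasure m U > 0"
    and invariant: "g \<in> isometry_group \<Longrightarrow> distr m borel g = m"
    and normalized: "B \<in> balls UNIV \<Longrightarrow> diameter B > 0 \<Longrightarrow> emeasure m B = ennreal (diameter B)"

text \<open>Diameter \<open>0\<close> is possible (singletons), but only when the space is discrete.\<close>

definition horocycle :: "'a::metric_space set \<Rightarrow> 'a set set \<Rightarrow> bool" where
  "horocycle S \<H> \<longleftrightarrow> (\<exists>B0 \<in> balls S. \<H> = {B \<in> balls S. diameter B = diameter B0})"

definition hierarchical_weight :: "'a::metric_space set \<Rightarrow> ('a set \<Rightarrow> real) \<Rightarrow> bool" where
  "hierarchical_weight S C \<longleftrightarrow>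
     (\<forall>B \<in> balls S. C B > 0) \<and> (\<forall>B \<in> balls S. C summable_on {T \<in> balls S. B \<subseteq> T})"

definition homogeneous_weight :: "'a::metric_space set \<Rightarrow> ('a set \<Rightarrow> real) \<Rightarrow> bool" where
  "homogeneous_weight S C \<longleftrightarrow>
     (\<forall>A \<in> balls S. \<forall>B \<in> balls S. diameter A = diameter B \<longrightarrow> C A = C B)"

definition test_functions :: "'a::metric_space measure \<Rightarrow> ('a \<Rightarrow> complex) set" where
  "test_functions m = {f \<in> extensional (space m).
     (\<forall>x \<in> space m. \<exists>U. openin (top_of_set (space m)) U \<and> x \<in> U \<and> f constant_on U) \<and>
     compact (closure {x \<in> space m. f x \<noteq> 0} \<inter> space m)}"

text \<open>The sum is unordered; for test functions it converges absolutely.\<close>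

definition hierarchical_Laplacian ::
  "'a::metric_space measure \<Rightarrow> ('a set \<Rightarrow> real) \<Rightarrow> ('a \<Rightarrow> complex) \<Rightarrow> 'a \<Rightarrow> complex" where
  "hierarchical_Laplacian m C f = (\<lambda>x \<in> space m.
     \<Sum>\<^sub>\<infinity>B \<in> {B \<in> balls (space m). x \<in> B}.
       of_real (C B) * (f x - (LINT y:B|m. f y) / of_real (measure m B)))"

definition add_potential ::
  "'a measure \<Rightarrow> (('a \<Rightarrow> complex) \<Rightarrow> 'a \<Rightarrow> complex) \<Rightarrow> ('a \<Rightarrow> real) \<Rightarrow> ('a \<Rightarrow> complex) \<Rightarrow> 'a \<Rightarrow> complex"
  where
  "add_potential m A V f = (\<lambda>x \<in> space m. A f x + of_real (V x) * f x)"

text \<open>Square-integrable functions stand for their a.e. classes.\<close>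

definition L2 :: "'a measure \<Rightarrow> ('a \<Rightarrow> complex) set" where
  "L2 m = {f \<in> extensional (space m).
     f \<in> borel_measurable m \<and> integrable m (\<lambda>x. (cmod (f x))\<^sup>2)}"

definition L2_inner :: "'a measure \<Rightarrow> ('a \<Rightarrow> complex) \<Rightarrow> ('a \<Rightarrow> complex) \<Rightarrow> complex" where
  "L2_inner m f g = (LINT x|m. f x * cnj (g x))"

definition L2_dist :: "'a measure \<Rightarrow> ('a \<Rightarrow> complex) \<Rightarrow> ('a \<Rightarrow> complex) \<Rightarrow> real" where
  "L2_dist m f g = sqrt (LINT x|m. (cmod (f x - g x))\<^sup>2)"

text \<open>
  The graph of the closure in \<open>L\<^sup>2\<close> of the operator \<open>A\<close> with domain \<^const>\<open>test_functions\<close>. It is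
  closed under a.e. equality in both components. The Bochner integral in
  \<^const>\<open>L2_dist\<close> is \<open>0\<close> for non-integrable functions, hence the explicit membership in \<^const>\<open>L2\<close>.
\<close>

definition closure_graph ::
  "'a::metric_space measure \<Rightarrow> (('a \<Rightarrow> complex) \<Rightarrow> 'a \<Rightarrow> complex)
     \<Rightarrow> (('a \<Rightarrow> complex) \<times> ('a \<Rightarrow> complex)) set" where
  "closure_graph m A = {(f, g). f \<in> L2 m \<and> g \<in> L2 m \<and>
     (\<exists>u. (\<forall>n::nat. u n \<in> test_functions m \<and> u n \<in> L2 m \<and> A (u n) \<in> L2 m) \<and>
          (\<lambda>n. L2_dist m (u n) f) \<longlonglongrightarrow> 0 \<and>
          (\<lambda>n. L2_dist m (A (u n)) g) \<longlonglongrightarrow> 0)}"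

text \<open>
  The closed span of the indicators of the balls in \<open>\<H>\<close>, each class being represented by its
  unique member that is constant on every \<open>B \<in> \<H>\<close>.
\<close>

definition L_plus :: "'a measure \<Rightarrow> 'a set set \<Rightarrow> ('a \<Rightarrow> complex) set" where
  "L_plus m \<H> = {f \<in> L2 m. \<forall>B \<in> \<H>. f constant_on B}"

definition invariant_subspace ::
  "'a measure \<Rightarrow> (('a \<Rightarrow> complex) \<times> ('a \<Rightarrow> complex)) set \<Rightarrow> ('a \<Rightarrow> complex) set \<Rightarrow> bool" where
  "invariant_subspace m G K \<longleftrightarrow>
     (\<forall>(f, g) \<in> G. f \<in> K \<longrightarrow> (\<exists>h \<in> K. AE x in m. g x = h x))"

text \<open>For an invariant \<open>K\<close>, intersecting the values with \<open>K\<close> only selects representatives.\<close>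

definition restriction_graph ::
  "(('a \<Rightarrow> complex) \<times> ('a \<Rightarrow> complex)) set \<Rightarrow> ('a \<Rightarrow> complex) set
     \<Rightarrow> (('a \<Rightarrow> complex) \<times> ('a \<Rightarrow> complex)) set" where
  "restriction_graph G K = G \<inter> (K \<times> K)"

definition unitary_between ::
  "'a measure \<Rightarrow> ('a \<Rightarrow> complex) set \<Rightarrow> 'b measure \<Rightarrow> ('b \<Rightarrow> complex) set
     \<Rightarrow> (('a \<Rightarrow> complex) \<Rightarrow> 'b \<Rightarrow> complex) \<Rightarrow> bool" where
  "unitary_between m K m' K' U \<longleftrightarrow>
     bij_betw U K K' \<and>
     (\<forall>f \<in> K. \<forall>g \<in> K. \<forall>c. U (\<lambda>x \<in> space m. c * f x + g x) = (\<lambda>y \<in> space m'. c * U f y + U g y)) \<and>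
     (\<forall>f \<in> K. \<forall>g \<in> K. L2_inner m' (U f) (U g) = L2_inner m f g)"

definition conjugate_graph ::
  "(('a \<Rightarrow> complex) \<Rightarrow> 'b \<Rightarrow> complex) \<Rightarrow> (('a \<Rightarrow> complex) \<times> ('a \<Rightarrow> complex)) set
     \<Rightarrow> (('b \<Rightarrow> complex) \<times> ('b \<Rightarrow> complex)) set" where
  "conjugate_graph U G = (\<lambda>(f, g). (U f, U g)) ` G"

end

theory Submission
  imports Defs
begin

text \<open>
  Fix a radius \<open>\<rho>\<close> whose closed balls form the horocycle; transitivity of the isometry group gives
  \<open>\<H> = {cball x \<rho>}\<close>. Let \<open>\<pi>\<close> send every point to the chosen point of its horocycle ball. Then
  \<open>m'\<close> is the image of \<open>m\<close> under \<open>\<pi>\<close>, so that \<open>f \<mapsto> f \<circ> \<pi>\<close> is an isometry of \<open>L\<^sup>2(m')\<close> onto \<open>\<L>\<^sub>+\<close>,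
  inverse to restriction. The balls of \<open>X'\<close> are the traces of the balls \<open>T\<close> of \<open>X\<close> that contain a
  horocycle ball, \<open>T\<close> can be recovered from its trace, and the weight of \<open>X'\<close> is transported along
  this bijection. For a function constant on a ball \<open>B\<close>, only the balls \<open>T \<supseteq> B\<close> contribute to the
  Laplacian on \<open>B\<close>; hence \<open>L (f \<circ> \<pi>) = (L' f) \<circ> \<pi>\<close>, which settles the inclusion of the closure of
  \<open>L'\<close> in the restriction of \<open>L\<close>.

  The rest needs functions that are not constant on horocycle balls, because the closure of \<open>L\<close> is
  formed from all test functions. Here the key identity (\<open>ball_average_Laplacian\<close>) is that the mean
  of \<open>L u\<close> over any ball \<open>B\<close> equals
  \<open>\<Sum>T\<supseteq>B. C(T) (mean of u over B - mean of u over T)\<close>,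
  since the summands of balls inside \<open>B\<close> have mean zero. It has two consequences.
  
  \<^item> The right-hand side is an \<open>L\<^sup>2\<close>-continuous functional of \<open>u\<close>, so the identity passes to the closed
    operator. If \<open>f\<close> is constant on the horocycle balls and \<open>(f, g)\<close> is in
    the closed graph, then all small balls in one horocycle ball give the same mean of \<open>g\<close>. Small
    balls generate the Borel sets, so \<open>g\<close> is almost everywhere constant on horocycle balls. This is
    the invariance of \<open>\<L>\<^sub>+\<close>.
  \<^item> Averaging over horocycle balls does not change means over larger balls, so it intertwines \<open>L\<close> with
    \<open>L'\<close> on test functions. As averaging is an \<open>L\<^sup>2\<close>-contraction, it maps approximating sequences for
    \<open>L\<close> to approximating sequences for \<open>L'\<close>; this is the other inclusion.

  A potential that is constant on horocycle balls commutes with averaging, so both operators are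
  treated at once, \<open>L\<close> being the case of the zero potential.
\<close>

section \<open>Balls of an ultrametric space with compact balls\<close>

context homogeneous_ultrametric_measure_space
begin

lemma sets_m: "sets m = sets borel"
  using radon by (simp add: radon_measure_def)

lemma space_m [simp]: "space m = UNIV"
  using sets_eq_imp_space_eq[OF sets_m] by simp

lemma cball_eq_of_mem:
  fixes x y :: 'a
  assumes "y \<in> cball x r"
  shows "cball y r = cball x r"
proof -
  have "cball u r \<subseteq> cball v r" if "dist u v \<le> r" for u v :: 'a
  proof
    fix z assume "z \<in> cball u r"
    then show "z \<in> cball v r"
      using ultrametric[of v z u] that by (auto simp: dist_commute)
  qed
  from this[of x y] this[of y x] assms show ?thesis
    by (auto simp: dist_commute)
qed

lemma ball_cases:
  assumes "B \<in> balls (UNIV :: 'a set)" "x \<in> B"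
  obtains r where "r > 0" "B = cball x r"
proof -
  from assms(1) obtain y r where r: "r > 0" "B = cball y r"
    by (auto simp: balls_def)
  then have "B = cball x r"
    using assms(2) cball_eq_of_mem by blast
  with r that show thesis by blast
qed

lemma cball_in_balls: "r > 0 \<Longrightarrow> cball (x::'a) r \<in> balls UNIV"
  by (auto simp: balls_def)

lemma balls_nonempty: "B \<in> balls (UNIV :: 'a set) \<Longrightarrow> B \<noteq> {}"
  by (auto simp: balls_def)

lemma balls_nested:
  assumes "B \<in> balls (UNIV :: 'a set)" "T \<in> balls UNIV" "x \<in> B" "x \<in> T"
  shows "B \<subseteq> T \<or> T \<subseteq> B"
proof -
  obtain r s where "B = cball x r" "T = cball x s"
    using assms by (metis ball_cases)
  then show ?thesis
    by (metis linear subset_cball)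
qed

lemma
  assumes "B \<in> balls (UNIV :: 'a set)"
  shows compact_ball: "compact B" and open_ball: "open B"
    and sets_ball [measurable]: "B \<in> sets m"
    and emeasure_ball: "emeasure m B = ennreal (measure m B)"
    and measure_ball_pos: "measure m B > 0"
proof -
  show *: "compact B"
    using assms compact_balls by (auto simp: balls_def)
  show **: "open B"
    unfolding open_contains_cball using assms by (metis ball_cases order_refl)
  show "B \<in> sets m"
    using ** sets_m by auto
  have "emeasure m B < \<infinity>"
    using radon * by (simp add: radon_measure_def)
  then show "emeasure m B = ennreal (measure m B)"
    by (intro emeasure_eq_ennreal_measure) auto
  moreover have "emeasure m B > 0"
    using full_support[OF **] balls_nonempty[OF assms] by simp
  ultimately show "measure m B > 0"
    by simp
qed

text \<open>
  Balls of radius \<open>r\<close> are open and form a partition, so a finite subcover already contains every one of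
  them that is centred in the compact set.
\<close>

lemma finite_cballs_meeting_compact:
  fixes S :: "'a set"
  assumes "compact S" "r > 0"
  shows "finite {cball x r | x. x \<in> S}"
proof -
  have "\<forall>x\<in>S. open (cball x r)"
    using assms(2) open_ball cball_in_balls by blast
 then have "\<And>x. x \<in> S \<Longrightarrow> open (cball x r)"
    by blast
  moreover have "S \<subseteq> (\<Union>x\<in>S. cball x r)"
    using assms(2) by force
  ultimately obtain P where P: "P \<subseteq> S" "finite P" "S \<subseteq> (\<Union>p\<in>P. cball p r)"
    by (rule compactE_image[OF assms(1)])
  have "{cball x r | x. x \<in> S} \<subseteq> (\<lambda>p. cball p r) ` P"
  proof clarify
    fix x assume "x \<in> S"
    then obtain p where p: "p \<in> P" "x \<in> cball p r"
      using P by blast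
    then show "cball x r \<in> (\<lambda>p. cball p r) ` P"
      using cball_eq_of_mem by blast
  qed
  then show ?thesis
    by (rule finite_subset) (simp add: P(2))
qed

text \<open>
  The space is the union of the compact balls of integral radius around one point.
\<close>

lemma countable_cballs:
  assumes "r > 0"
  shows "countable (range (\<lambda>x::'a. cball x r))"
proof -
  fix z :: 'a
  have "range (\<lambda>x. cball x r) \<subseteq> (\<Union>n::nat. {cball x r | x. x \<in> cball z (real n)})"
  proof clarify
    fix x :: 'a
    have "x \<in> cball z (real (nat \<lceil>dist z x\<rceil>))"
      by (simp add: real_nat_ceiling_ge)
    then show "cball x r \<in> (\<Union>n::nat. {cball x r | x. x \<in> cball z (real n)})"
      by blast
  qed
  moreover have "countable \<dots>"
    by (intro countable_UN countableI_type countable_finite finite_cballs_meeting_compact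
        compact_balls assms)
  ultimately show ?thesis
    by (rule countable_subset)
qed

text \<open>
  A ball that contains one \<open>r\<close>-ball is a union of \<open>r\<close>-balls, and \<open>B\<close> contains only finitely many of
  these by compactness.
\<close>

lemma finite_intermediate_balls:
  assumes "B \<in> balls (UNIV :: 'a set)" "r > 0"
  shows "finite {T \<in> balls UNIV. T \<subseteq> B \<and> (\<exists>x\<in>T. cball x r \<subseteq> T)}"
proof (rule finite_subset)
  show "finite (Union ` Pow {cball x r | x. x \<in> B})"
    using finite_cballs_meeting_compact[OF compact_ball[OF assms(1)] assms(2)] by simp
  show "{T \<in> balls UNIV. T \<subseteq> B \<and> (\<exists>x\<in>T. cball x r \<subseteq> T)} \<subseteq> Union ` Pow {cball x r | x. x \<in> B}"
  proof clarify
    fix T x assume T: "T \<in> balls UNIV" "T \<subseteq> B" "x \<in> T" "cball x r \<subseteq> T"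
    have sub: "cball y r \<subseteq> T" if y: "y \<in> T" for y
    proof (rule ccontr)
      assume n: "\<not> cball y r \<subseteq> T"
      then have "T \<subseteq> cball y r"
        using balls_nested[OF cball_in_balls[OF assms(2), of y] T(1), of y] y assms(2) by auto
      moreover from this have "cball x r = cball y r"
        using T(3) cball_eq_of_mem[of x y r] by blast
      ultimately show False
        using T(4) n by blast
    qed
    have "T = \<Union>{cball y r | y. y \<in> T}"
    proof
      have "y \<in> cball y r" for y :: 'a
        using assms(2) by simp
      then show "T \<subseteq> \<Union>{cball y r | y. y \<in> T}"
        by blast
      show "\<Union>{cball y r | y. y \<in> T} \<subseteq> T"
        using sub by blast
    qed
    moreover have "{cball y r | y. y \<in> T} \<in> Pow {cball x r | x. x \<in> B}"
      using T(2) by blast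
    ultimately show "T \<in> Union ` Pow {cball x r | x. x \<in> B}"
      by (rule image_eqI)
  qed
qed

lemma ball_eq_cball_diameter:
  assumes "B \<in> balls (UNIV :: 'a set)" "x \<in> B"
  shows "B = cball x (diameter B)"
proof
  have bd: "bounded B"
    using compact_ball[OF assms(1)] by (rule compact_imp_bounded)
  obtain r where r: "r > 0" "B = cball x r"
    using assms by (rule ball_cases)
  show "B \<subseteq> cball x (diameter B)"
    using diameter_bounded_bound[OF bd assms(2)] by auto
  have "dist y z \<le> r" if "y \<in> B" "z \<in> B" for y z
    using that r ultrametric[of y z x] by (auto simp: dist_commute)
  then have "diameter B \<le> r"
    unfolding diameter_def using assms(2) by (auto intro!: cSUP_least)
  then show "cball x (diameter B) \<subseteq> B"
    by (simp add: r(2) subset_cball)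
qed

text \<open>
  Diameters say less than radii when balls are singletons of diameter \<open>0\<close>, so a
  horocycle is better described by a positive radius. Isometries make all balls of one radius equally large, and a
  ball is determined by its diameter and any of its points.
\<close>

lemma horocycle_eq_cballs:
  assumes "horocycle (UNIV :: 'a set) \<H>"
  obtains \<rho> where "\<rho> > 0" "\<H> = range (\<lambda>x. cball x \<rho>)"
proof -
  obtain B0 :: "'a set" where B0: "B0 \<in> balls UNIV" "\<H> = {B \<in> balls UNIV. diameter B = diameter B0}"
    using assms unfolding horocycle_def by blast
  obtain x0 where "x0 \<in> B0"
    using balls_nonempty[OF B0(1)] by blast
  then obtain \<rho> where \<rho>: "\<rho> > 0" "B0 = cball x0 \<rho>"
    using B0(1) by (metis ball_cases)
  have le: "diameter (cball x \<rho>) \<le> diameter (cball y \<rho>)" for x y :: 'a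
  proof -
    obtain g where g: "bij g" "\<And>u v. dist (g u) (g v) = dist u v" "g y = x"
      using transitive[of y x] by (auto simp: isometry_group_def)
    have bd: "bounded (cball y \<rho>)"
      by simp
    have "dist u v \<le> diameter (cball y \<rho>)" if "u \<in> cball x \<rho>" "v \<in> cball x \<rho>" for u v
    proof -
      obtain u' v' where uv: "u = g u'" "v = g v'"
        using g(1) by (metis bij_pointE)
      have "u' \<in> cball y \<rho>" "v' \<in> cball y \<rho>"
        using that g(2)[of y u'] g(2)[of y v'] g(3) uv by auto
      then show ?thesis
        using diameter_bounded_bound[OF bd] g(2) uv by simp
    qed
    then show ?thesis
      using \<rho>(1) unfolding diameter_def[of "cball x \<rho>"] by (auto intro!: cSUP_least)
  qed
  have diam: "diameter (cball x \<rho>) = diameter B0" for x :: 'a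
    unfolding \<rho>(2) by (intro antisym le)
  have "\<H> = range (\<lambda>x. cball x \<rho>)"
  proof (intro set_eqI iffI)
    fix B assume "B \<in> \<H>"
    then have B: "B \<in> balls UNIV" "diameter B = diameter B0"
      by (auto simp: B0(2))
    then obtain x where x: "x \<in> B"
      using balls_nonempty by blast
    have "B = cball x (diameter (cball x \<rho>))"
      using ball_eq_cball_diameter[OF B(1) x] B(2) diam by simp
    also have "\<dots> = cball x \<rho>"
      using ball_eq_cball_diameter[OF cball_in_balls[OF \<rho>(1)], of x] \<rho>(1) by simp
    finally show "B \<in> range (\<lambda>x. cball x \<rho>)"
      by blast
  next
    fix B :: "'a set" assume "B \<in> range (\<lambda>x. cball x \<rho>)"
    then show "B \<in> \<H>"
      using diam \<rho>(1) cball_in_balls by (auto simp: B0(2))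
  qed
  with \<rho>(1) that show thesis
    by blast
qed

text \<open>
  Cover the support by open sets on which \<open>u\<close> is constant; a Lebesgue number of this cover provides the
  scale for balls centred in the support. An \<open>r\<close>-ball that meets the
  support is also centred at a point of the support; on any other \<open>r\<close>-ball the function vanishes.
\<close>

lemma uniform_scale_of_test_function:
  assumes "u \<in> test_functions m"
  obtains r where "r > 0" "\<And>x. u constant_on cball x r"
proof -
  have loc: "\<exists>U. open U \<and> x \<in> U \<and> u constant_on U" for x
    using assms by (auto simp: test_functions_def)
  define S where "S = {x. u x \<noteq> 0}"
  have "open (- S)"
  proof (subst open_subopen, intro ballI)
    fix x assume x: "x \<in> - S"
    obtain U where "open U" "x \<in> U" "u constant_on U"
      using loc by blast
    with x show "\<exists>T. open T \<and> x \<in> T \<and> T \<subseteq> - S"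
      by (intro exI[of _ U]) (auto simp: S_def constant_on_def)
  qed
  then have S: "compact S"
    using assms by (simp add: test_functions_def S_def closed_def)
  obtain U where U: "\<And>x. open (U x)" "\<And>x. x \<in> U x" "\<And>x. u constant_on (U x)"
    using loc by metis
  have "S \<subseteq> \<Union>(range U)" "\<And>B. B \<in> range U \<Longrightarrow> open B"
    using U by auto
  from Heine_Borel_lemma[OF S this]
  obtain e where e: "e > 0" "\<And>x. x \<in> S \<Longrightarrow> \<exists>B\<in>range U. ball x e \<subseteq> B"
    by blast
  have *: "u constant_on cball x (e/2)" if "x \<in> S" for x
  proof -
    have "cball x (e/2) \<subseteq> ball x e"
      using e(1) by auto
    then show ?thesis
      using e(2)[OF that] U(3) by (metis constant_on_subset imageE)
  qed
  have "u constant_on cball x (e/2)" for x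
  proof (cases "cball x (e/2) \<inter> S = {}")
    case True
    then show ?thesis
      by (auto simp: S_def constant_on_def)
  next
    case False
    then obtain s where "s \<in> S" "s \<in> cball x (e/2)"
      by blast
    then show ?thesis
      using * cball_eq_of_mem by metis
  qed
  with e(1) that[of "e/2"] show thesis
    by simp
qed

end

section \<open>Means over balls and the Laplacian\<close>

definition ball_average :: "'a measure \<Rightarrow> 'a set \<Rightarrow> ('a \<Rightarrow> complex) \<Rightarrow> complex" where
  "ball_average m B f = (LINT y:B|m. f y) / of_real (measure m B)"

text \<open>
  The mean over \<open>B\<close> of the Laplacian of \<open>f\<close>, in a form that makes sense for every \<open>f\<close> in \<open>L\<^sup>2\<close>.
\<close>

definition averaged_Laplacian ::
  "'a::metric_space measure \<Rightarrow> ('a set \<Rightarrow> real) \<Rightarrow> ('a \<Rightarrow> complex) \<Rightarrow> 'a set \<Rightarrow> complex" where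
  "averaged_Laplacian m C f B =
     (\<Sum>\<^sub>\<infinity>T\<in>{T \<in> balls UNIV. B \<subseteq> T}. of_real (C T) * (ball_average m B f - ball_average m T f))"

context homogeneous_ultrametric_measure_space
begin

lemma L2_iff: "f \<in> L2 m \<longleftrightarrow> f \<in> borel_measurable m \<and> integrable m (\<lambda>x. (cmod (f x))\<^sup>2)"
  by (simp add: L2_def)

lemma L2_diff:
  assumes "f \<in> L2 m" "g \<in> L2 m"
  shows "(\<lambda>x. f x - g x) \<in> L2 m"
proof -
  have [measurable]: "f \<in> borel_measurable m" "g \<in> borel_measurable m"
    using assms by (auto simp: L2_iff)
  have "integrable m (\<lambda>x. 2 * (cmod (f x))\<^sup>2 + 2 * (cmod (g x))\<^sup>2)"
    using assms by (auto simp: L2_iff)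
  then have "integrable m (\<lambda>x. (cmod (f x - g x))\<^sup>2)"
  proof (rule Bochner_Integration.integrable_bound)
    have "(cmod (f x - g x))\<^sup>2 \<le> 2 * (cmod (f x))\<^sup>2 + 2 * (cmod (g x))\<^sup>2" for x
    proof -
      have "(cmod (f x - g x))\<^sup>2 \<le> (cmod (f x) + cmod (g x))\<^sup>2"
        by (intro power_mono norm_triangle_ineq4 norm_ge_zero)
      also have "\<dots> \<le> 2 * (cmod (f x))\<^sup>2 + 2 * (cmod (g x))\<^sup>2"
        using sum_squares_bound[of "cmod (f x)" "cmod (g x)"] by (simp add: power2_sum)
      finally show ?thesis .
    qed
    then show "AE x in m. norm ((cmod (f x - g x))\<^sup>2) \<le> norm (2 * (cmod (f x))\<^sup>2 + 2 * (cmod (g x))\<^sup>2)"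
      by (intro AE_I2) simp
  qed measurable
  then show ?thesis
    by (simp add: L2_iff)
qed

lemma set_integrable_const_ball:
  "B \<in> balls UNIV \<Longrightarrow> set_integrable m B (\<lambda>x. c :: complex)"
  unfolding set_integrable_def
  by (intro integrable_scaleR_left integrable_real_indicator) (auto simp: emeasure_ball)

lemma L2_set_integrable_ball:
  assumes "f \<in> L2 m" "B \<in> balls UNIV"
  shows "set_integrable m B f"
proof -
  have f[measurable]: "f \<in> borel_measurable m" and i: "integrable m (\<lambda>x. (cmod (f x))\<^sup>2)"
    using assms by (auto simp: L2_iff)
  have [measurable]: "B \<in> sets m"
    using assms(2) by (rule sets_ball)
  have "integrable m (\<lambda>x. indicator B x + (cmod (f x))\<^sup>2 :: real)"
    using i assms(2) by (intro Bochner_Integration.integrable_add integrable_real_indicator)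
      (auto simp: emeasure_ball)
  then show ?thesis
    unfolding set_integrable_def
  proof (rule Bochner_Integration.integrable_bound)
    have "cmod z \<le> 1 + (cmod z)\<^sup>2" for z
      using sum_squares_bound[of 1 "cmod z"] norm_ge_zero[of z] by (simp del: norm_ge_zero)
    then show "AE x in m. norm (indicat_real B x *\<^sub>R f x) \<le> norm (indicator B x + (cmod (f x))\<^sup>2 :: real)"
      by (intro AE_I2) (auto simp: indicator_def)
  qed measurable
qed

lemma ball_average_diff:
  assumes "set_integrable m B f" "set_integrable m B g"
  shows "ball_average m B (\<lambda>x. f x - g x) = ball_average m B f - ball_average m B g"
  using assms by (simp add: ball_average_def diff_divide_distrib)

lemma ball_average_cong:
  assumes "\<And>x. x \<in> B \<Longrightarrow> f x = g x"
  shows "ball_average m B f = ball_average m B g"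
proof -
  have "(LINT y:B|m. f y) = (LINT y:B|m. g y)"
    unfolding set_lebesgue_integral_def
    using assms by (intro Bochner_Integration.integral_cong) (auto simp: indicator_def)
  then show ?thesis
    by (simp add: ball_average_def)
qed

lemma ball_average_const:
  assumes "B \<in> balls UNIV"
  shows "ball_average m B (\<lambda>x. c) = c"
proof -
  have "(LINT y:B|m. c) = of_real (measure m B) * c"
    using assms emeasure_ball[OF assms]
    by (simp add: set_lebesgue_integral_def scaleR_conv_of_real)
  then show ?thesis
    using measure_ball_pos[OF assms] by (simp add: ball_average_def)
qed

lemma ball_average_constant_on:
  assumes "f constant_on B" "B \<in> balls UNIV" "x \<in> B"
  shows "ball_average m B f = f x"
proof -
  have "ball_average m B f = ball_average m B (\<lambda>y. f x)"
    using assms by (intro ball_average_cong) (auto simp: constant_on_def)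
  then show ?thesis
    by (simp add: ball_average_const assms(2))
qed

lemma measure_ball_mono:
  assumes "B \<in> balls UNIV" "T \<in> balls UNIV" "B \<subseteq> T"
  shows "measure m B \<le> measure m T"
  using assms emeasure_ball[OF assms(2)]
  by (intro measure_mono_fmeasurable) (auto simp: fmeasurable_def sets_ball)

text \<open>
  Cauchy-Schwarz, in terms of nonnegative integrals so that the inequality can be summed over a
  partition into balls before square-integrability of the averages is known.
\<close>

lemma ball_average_square_le:
  assumes [measurable]: "f \<in> borel_measurable m" and B: "B \<in> balls UNIV"
  shows "ennreal ((cmod (ball_average m B f))\<^sup>2) * emeasure m B \<le> (\<integral>\<^sup>+x\<in>B. ennreal ((cmod (f x))\<^sup>2) \<partial>m)"
proof -
  note [measurable] = sets_ball[OF B]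
  define s where "s = cmod (LINT y:B|m. f y)"
  define M where "M = measure m B"
  define J where "J = (\<integral>\<^sup>+x\<in>B. ennreal ((cmod (f x))\<^sup>2) \<partial>m)"
  have M: "M > 0" "emeasure m B = ennreal M"
    using B by (auto simp: M_def measure_ball_pos emeasure_ball)
  have "ennreal s \<le> (\<integral>\<^sup>+x. ennreal (norm (indicat_real B x *\<^sub>R f x)) \<partial>m)"
  proof (cases "set_integrable m B f")
    case True
    then show ?thesis
      unfolding s_def set_lebesgue_integral_def set_integrable_def
      by (rule integral_norm_bound_ennreal)
  next
    case False
    then show ?thesis
      unfolding s_def set_lebesgue_integral_def set_integrable_def
      by (simp add: not_integrable_integral_eq)
  qed
  also have "\<dots> = (\<integral>\<^sup>+x. (ennreal (cmod (f x)) * indicator B x) * indicator B x \<partial>m)"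
    by (intro nn_integral_cong) (auto simp: indicator_def)
  finally have "(ennreal s)\<^sup>2 \<le> (\<integral>\<^sup>+x. (ennreal (cmod (f x)) * indicator B x) * indicator B x \<partial>m)\<^sup>2"
    by (rule power_mono) simp
  also have "\<dots> \<le> (\<integral>\<^sup>+x. (ennreal (cmod (f x)) * indicator B x)\<^sup>2 \<partial>m) * (\<integral>\<^sup>+x. (indicator B x)\<^sup>2 \<partial>m)"
    by (rule Cauchy_Schwarz_nn_integral) measurable
  also have "(\<integral>\<^sup>+x. (ennreal (cmod (f x)) * indicator B x)\<^sup>2 \<partial>m) = J"
    unfolding J_def by (intro nn_integral_cong) (auto simp: indicator_def ennreal_power)
  also have "(\<integral>\<^sup>+x. (indicator B x)\<^sup>2 \<partial>m) = (\<integral>\<^sup>+x. indicator B x \<partial>m)"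
    by (intro nn_integral_cong) (auto simp: indicator_def)
  also have "\<dots> = ennreal M"
    using M by simp
  finally have "ennreal (s\<^sup>2) \<le> J * ennreal M"
    by (simp add: ennreal_power s_def)
  then have "ennreal (s\<^sup>2) * ennreal (1/M) \<le> J * ennreal M * ennreal (1/M)"
    by (rule mult_right_mono) simp
  also have "\<dots> = J"
    using M(1) by (simp add: mult.assoc flip: ennreal_mult)
  finally have "ennreal (s\<^sup>2 / M) \<le> J"
    using M(1) by (simp flip: ennreal_mult)
  moreover have "(cmod (ball_average m B f))\<^sup>2 * M = s\<^sup>2 / M"
    using M(1) by (simp add: ball_average_def s_def M_def norm_divide power2_eq_square)
  ultimately show ?thesis
    using M by (simp add: J_def flip: ennreal_mult)
qed

lemma ball_average_bound:
  assumes "f \<in> L2 m" and B: "B \<in> balls UNIV"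
  shows "cmod (ball_average m B f) \<le> sqrt (LINT x|m. (cmod (f x))\<^sup>2) / sqrt (measure m B)"
proof -
  define N where "N = (LINT x|m. (cmod (f x))\<^sup>2)"
  have f[measurable]: "f \<in> borel_measurable m" and i: "integrable m (\<lambda>x. (cmod (f x))\<^sup>2)"
    using assms by (auto simp: L2_iff)
  have M: "measure m B > 0"
    using B by (rule measure_ball_pos)
  have "ennreal ((cmod (ball_average m B f))\<^sup>2 * measure m B)
      \<le> (\<integral>\<^sup>+x\<in>B. ennreal ((cmod (f x))\<^sup>2) \<partial>m)"
    using ball_average_square_le[OF f B] by (simp add: emeasure_ball[OF B] ennreal_mult)
  also have "\<dots> \<le> (\<integral>\<^sup>+x. ennreal ((cmod (f x))\<^sup>2) \<partial>m)"
    by (intro nn_integral_mono) (auto simp: indicator_def)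
  also have "\<dots> = ennreal N"
    unfolding N_def using i by (intro nn_integral_eq_integral) auto
  finally have "(cmod (ball_average m B f))\<^sup>2 * measure m B \<le> N"
    by (subst (asm) ennreal_le_iff) (auto simp: N_def)
  then have "(cmod (ball_average m B f))\<^sup>2 \<le> N / measure m B"
    using M by (simp add: field_simps)
  then have "cmod (ball_average m B f) \<le> sqrt (N / measure m B)"
    by (rule real_le_rsqrt)
  then show ?thesis
    by (simp add: N_def real_sqrt_divide)
qed

lemma ball_average_dist_bound:
  assumes "f \<in> L2 m" "g \<in> L2 m" "B \<in> balls UNIV"
  shows "cmod (ball_average m B f - ball_average m B g) \<le> L2_dist m f g / sqrt (measure m B)"
  using ball_average_bound[OF L2_diff[OF assms(1,2)] assms(3)]
  by (simp add: L2_dist_def ball_average_diff L2_set_integrable_ball assms)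

lemma ball_average_tendsto:
  assumes "\<And>n. u n \<in> L2 m" "f \<in> L2 m" "(\<lambda>n. L2_dist m (u n) f) \<longlonglongrightarrow> 0" "B \<in> balls UNIV"
  shows "(\<lambda>n. ball_average m B (u n)) \<longlonglongrightarrow> ball_average m B f"
proof (rule Lim_null[THEN iffD2], rule Lim_null_comparison)
  show "\<forall>\<^sub>F n in sequentially. cmod (ball_average m B (u n) - ball_average m B f)
      \<le> L2_dist m (u n) f / sqrt (measure m B)"
    using ball_average_dist_bound assms by (intro always_eventually allI) blast
  show "(\<lambda>n. L2_dist m (u n) f / sqrt (measure m B)) \<longlonglongrightarrow> 0"
    using tendsto_divide_zero[OF assms(3)] by blast
qed

context
  fixes C :: "'a set \<Rightarrow> real"
  assumes C: "hierarchical_weight UNIV C"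
begin

lemma weight_bounded_summable:
  fixes c :: "'a set \<Rightarrow> complex"
  assumes "B \<in> balls UNIV" "\<And>T. T \<in> balls UNIV \<Longrightarrow> B \<subseteq> T \<Longrightarrow> cmod (c T) \<le> K"
  shows "(\<lambda>T. of_real (C T) * c T) summable_on {T \<in> balls UNIV. B \<subseteq> T}"
proof (rule abs_summable_summable, rule Infinite_Sum.abs_summable_on_comparison_test')
  show "(\<lambda>T. C T * K) summable_on {T \<in> balls UNIV. B \<subseteq> T}"
    using C assms(1) by (intro summable_on_cmult_left) (simp add: hierarchical_weight_def)
  show "norm (of_real (C T) * c T) \<le> C T * K" if "T \<in> {T \<in> balls UNIV. B \<subseteq> T}" for T
    using that C assms(2)[of T] unfolding norm_mult norm_of_real hierarchical_weight_def
    by (intro mult_mono) (auto intro: less_imp_le)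
qed

lemma ball_average_bound_above:
  assumes "f \<in> L2 m" "B \<in> balls UNIV" "T \<in> balls UNIV" "B \<subseteq> T"
  shows "cmod (ball_average m T f) \<le> sqrt (LINT x|m. (cmod (f x))\<^sup>2) / sqrt (measure m B)"
proof -
  have "cmod (ball_average m T f) \<le> sqrt (LINT x|m. (cmod (f x))\<^sup>2) / sqrt (measure m T)"
    using assms by (intro ball_average_bound)
  also have "\<dots> \<le> sqrt (LINT x|m. (cmod (f x))\<^sup>2) / sqrt (measure m B)"
    using measure_ball_mono[OF assms(2-4)] measure_ball_pos[OF assms(2)]
    by (intro divide_left_mono) auto
  finally show ?thesis .
qed

lemma averaged_Laplacian_summable:
  assumes "f \<in> L2 m" "B \<in> balls UNIV"
  shows "(\<lambda>T. of_real (C T) * (ball_average m B f - ball_average m T f))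
    summable_on {T \<in> balls UNIV. B \<subseteq> T}"
proof (rule weight_bounded_summable[OF assms(2)])
  fix T assume "T \<in> balls UNIV" "B \<subseteq> T"
  then show "cmod (ball_average m B f - ball_average m T f)
      \<le> 2 * (sqrt (LINT x|m. (cmod (f x))\<^sup>2) / sqrt (measure m B))"
    using ball_average_bound_above[OF assms, of T] ball_average_bound_above[OF assms(1,2,2)]
      norm_triangle_ineq4[of "ball_average m B f" "ball_average m T f"] by simp
qed

lemma averaged_Laplacian_diff:
  assumes "f \<in> L2 m" "g \<in> L2 m" "B \<in> balls UNIV"
  shows "averaged_Laplacian m C (\<lambda>x. f x - g x) B = averaged_Laplacian m C f B - averaged_Laplacian m C g B"
proof -
  let ?A = "{T \<in> balls UNIV. B \<subseteq> T}"
  let ?s = "\<lambda>f T. of_real (C T) * (ball_average m B f - ball_average m T f)"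
  have "averaged_Laplacian m C f B = (\<Sum>\<^sub>\<infinity>T\<in>?A. ?s (\<lambda>x. f x - g x) T + ?s g T)"
    unfolding averaged_Laplacian_def
    using assms by (intro infsum_cong) (simp add: ball_average_diff L2_set_integrable_ball algebra_simps)
  also have "\<dots> = averaged_Laplacian m C (\<lambda>x. f x - g x) B + averaged_Laplacian m C g B"
    unfolding averaged_Laplacian_def
    using assms by (intro infsum_add averaged_Laplacian_summable L2_diff)
  finally show ?thesis
    by simp
qed

lemma averaged_Laplacian_bound:
  assumes "f \<in> L2 m" "B \<in> balls UNIV"
  shows "cmod (averaged_Laplacian m C f B)
    \<le> (\<Sum>\<^sub>\<infinity>T\<in>{T \<in> balls UNIV. B \<subseteq> T}. C T) * (2 * (sqrt (LINT x|m. (cmod (f x))\<^sup>2) / sqrt (measure m B)))"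
proof (rule norm_infsum_le)
  let ?A = "{T \<in> balls UNIV. B \<subseteq> T}"
  let ?K = "2 * (sqrt (LINT x|m. (cmod (f x))\<^sup>2) / sqrt (measure m B))"
  have s: "C summable_on ?A"
    using C assms(2) by (simp add: hierarchical_weight_def)
  show "((\<lambda>T. of_real (C T) * (ball_average m B f - ball_average m T f)) has_sum averaged_Laplacian m C f B) ?A"
    unfolding averaged_Laplacian_def by (intro has_sum_infsum averaged_Laplacian_summable assms)
  show "((\<lambda>T. C T * ?K) has_sum (\<Sum>\<^sub>\<infinity>T\<in>?A. C T) * ?K) ?A"
    by (intro has_sum_cmult_left has_sum_infsum s)
  fix T assume T: "T \<in> ?A"
  then have "cmod (ball_average m B f - ball_average m T f) \<le> ?K"
    using ball_average_bound_above[OF assms, of T] ball_average_bound_above[OF assms(1,2,2)]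
      norm_triangle_ineq4[of "ball_average m B f" "ball_average m T f"] by simp
  then show "norm (of_real (C T) * (ball_average m B f - ball_average m T f)) \<le> C T * ?K"
    using T C unfolding norm_mult norm_of_real hierarchical_weight_def
    by (intro mult_mono) (auto intro: less_imp_le)
qed

text \<open>
  By Cauchy-Schwarz a mean over a ball \<open>T \<supseteq> B\<close> is bounded by the \<open>L\<^sup>2\<close> norm over \<open>sqrt (m B)\<close>, uniformly
  in \<open>T\<close>, and the weights of these \<open>T\<close> are summable.
\<close>

lemma averaged_Laplacian_tendsto:
  assumes "\<And>n. u n \<in> L2 m" "f \<in> L2 m" "(\<lambda>n. L2_dist m (u n) f) \<longlonglongrightarrow> 0" "B \<in> balls UNIV"
  shows "(\<lambda>n. averaged_Laplacian m C (u n) B) \<longlonglongrightarrow> averaged_Laplacian m C f B"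
proof (rule Lim_null[THEN iffD2], rule Lim_null_comparison)
  let ?\<Lambda> = "\<Sum>\<^sub>\<infinity>T\<in>{T \<in> balls UNIV. B \<subseteq> T}. C T"
  show "\<forall>\<^sub>F n in sequentially. cmod (averaged_Laplacian m C (u n) B - averaged_Laplacian m C f B)
      \<le> ?\<Lambda> * (2 * (L2_dist m (u n) f / sqrt (measure m B)))"
  proof (intro always_eventually allI)
    fix n
    show "cmod (averaged_Laplacian m C (u n) B - averaged_Laplacian m C f B)
      \<le> ?\<Lambda> * (2 * (L2_dist m (u n) f / sqrt (measure m B)))"
      using averaged_Laplacian_bound[OF L2_diff[OF assms(1)[of n] assms(2)] assms(4)]
        averaged_Laplacian_diff[OF assms(1)[of n] assms(2,4)] by (simp add: L2_dist_def)
  qed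
  show "(\<lambda>n. ?\<Lambda> * (2 * (L2_dist m (u n) f / sqrt (measure m B)))) \<longlonglongrightarrow> 0"
    by (intro tendsto_mult_right_zero tendsto_divide_zero assms(3))
qed

text \<open>
  A ball containing \<open>x\<close> either contains \<open>B\<close> or lies inside \<open>B\<close>, where \<open>f\<close> equals its mean.
\<close>

lemma Laplacian_eq_averaged_Laplacian:
  assumes "f constant_on B" "B \<in> balls UNIV" "x \<in> B"
  shows "hierarchical_Laplacian m C f x = averaged_Laplacian m C f B"
proof -
  have "hierarchical_Laplacian m C f x
      = (\<Sum>\<^sub>\<infinity>T\<in>{T \<in> balls UNIV. x \<in> T}. of_real (C T) * (f x - ball_average m T f))"
    by (simp add: hierarchical_Laplacian_def ball_average_def)
  also have "\<dots> = averaged_Laplacian m C f B"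
    unfolding averaged_Laplacian_def
  proof (rule infsum_cong_neutral)
    fix T assume "T \<in> {T \<in> balls UNIV. x \<in> T} - {T \<in> balls UNIV. B \<subseteq> T}"
    then have T: "T \<in> balls UNIV" "x \<in> T" "T \<subseteq> B"
      using balls_nested[OF assms(2) _ assms(3)] by auto
    then show "of_real (C T) * (f x - ball_average m T f) = 0"
      using ball_average_constant_on[of f T x] constant_on_subset[OF assms(1), of T] by simp
  qed (use assms ball_average_constant_on in auto)
  finally show ?thesis .
qed

text \<open>
  On \<open>B\<close> the Laplacian splits into the balls above \<open>B\<close> and those strictly inside \<open>B\<close>. The first part is
  affine in \<open>u\<close> and has the asserted mean. In the second only the finitely many balls \<open>T\<close> on which \<open>u\<close> is
  not constant matter, and each contributes \<open>C(T) (u - mean of u over T)\<close> on \<open>T\<close>, whose integral is zero.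
\<close>

lemma ball_average_Laplacian:
  assumes "u \<in> test_functions m" "u \<in> L2 m" "B \<in> balls UNIV"
  shows "set_integrable m B (hierarchical_Laplacian m C u)"
    and "ball_average m B (hierarchical_Laplacian m C u) = averaged_Laplacian m C u B"
proof -
  obtain r where r: "r > 0" "\<And>x. u constant_on cball x r"
    using uniform_scale_of_test_function[OF assms(1)] by metis
  \<comment> \<open>\<open>F\<close> is finite: its members are larger than the scale on which \<open>u\<close> is constant.\<close>
  define F where "F = {T \<in> balls UNIV. T \<subset> B \<and> \<not> u constant_on T}"
  define \<Lambda> where "\<Lambda> = (\<Sum>\<^sub>\<infinity>T\<in>{T \<in> balls UNIV. B \<subseteq> T}. complex_of_real (C T))"
  define c where "c = (\<Sum>\<^sub>\<infinity>T\<in>{T \<in> balls UNIV. B \<subseteq> T}. of_real (C T) * ball_average m T u)"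
  note int = L2_set_integrable_ball[OF assms(2)]
  have fin: "finite F"
  proof (rule finite_subset[OF _ finite_intermediate_balls[OF assms(3) r(1)]], rule subsetI)
    fix T assume T: "T \<in> F"
    then obtain x where x: "x \<in> T"
      using balls_nonempty by (auto simp: F_def)
    moreover have "cball x r \<subseteq> T"
      using T x r balls_nested[OF cball_in_balls[OF r(1), of x], of T x] constant_on_subset[OF r(2)]
      by (auto simp: F_def)
    ultimately show "T \<in> {T \<in> balls UNIV. T \<subseteq> B \<and> (\<exists>x\<in>T. cball x r \<subseteq> T)}"
      using T by (auto simp: F_def)
  qed
  have s1: "(\<lambda>T. complex_of_real (C T)) summable_on {T \<in> balls UNIV. B \<subseteq> T}"
    using weight_bounded_summable[OF assms(3), of "\<lambda>_. 1" 1] by simp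
  have s2: "(\<lambda>T. of_real (C T) * ball_average m T u) summable_on {T \<in> balls UNIV. B \<subseteq> T}"
    by (rule weight_bounded_summable[OF assms(3) ball_average_bound_above[OF assms(2,3)]])
  have minus: "infsum (\<lambda>T. of_real (C T) * (z - ball_average m T u)) {T \<in> balls UNIV. B \<subseteq> T} = z * \<Lambda> - c"
    and sminus: "(\<lambda>T. of_real (C T) * (z - ball_average m T u)) summable_on {T \<in> balls UNIV. B \<subseteq> T}" for z
  proof -
    have "((\<lambda>T. z * of_real (C T) + - 1 * (of_real (C T) * ball_average m T u)) has_sum z * \<Lambda> + - 1 * c)
        {T \<in> balls UNIV. B \<subseteq> T}"
      unfolding \<Lambda>_def c_def
      by (intro has_sum_add has_sum_cmult_right has_sum_infsum s1 s2)
    then have h: "((\<lambda>T. of_real (C T) * (z - ball_average m T u)) has_sum z * \<Lambda> - c)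
        {T \<in> balls UNIV. B \<subseteq> T}"
      by (simp add: algebra_simps)
    then show "infsum (\<lambda>T. of_real (C T) * (z - ball_average m T u)) {T \<in> balls UNIV. B \<subseteq> T} = z * \<Lambda> - c"
      by (rule infsumI)
    from h show "(\<lambda>T. of_real (C T) * (z - ball_average m T u)) summable_on {T \<in> balls UNIV. B \<subseteq> T}"
      by (rule has_sum_imp_summable)
  qed
  define g where "g = (\<lambda>x. (u x * \<Lambda> - c) +
      (\<Sum>T\<in>F. indicator T x *\<^sub>R (of_real (C T) * (u x - ball_average m T u))))"
  have Lu: "hierarchical_Laplacian m C u x = g x" if x: "x \<in> B" for x
  proof -
    let ?s = "\<lambda>T. of_real (C T) * (u x - ball_average m T u)"
    have "hierarchical_Laplacian m C u x = infsum ?s {T \<in> balls UNIV. x \<in> T}"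
      by (simp add: hierarchical_Laplacian_def ball_average_def)
    also have "\<dots> = infsum ?s ({T \<in> balls UNIV. B \<subseteq> T} \<union> {T \<in> F. x \<in> T})"
    proof (rule infsum_cong_neutral)
      fix T assume "T \<in> {T \<in> balls UNIV. x \<in> T} - ({T \<in> balls UNIV. B \<subseteq> T} \<union> {T \<in> F. x \<in> T})"
      then have "T \<in> balls UNIV" "x \<in> T" "u constant_on T"
        using balls_nested[OF assms(3) _ x, of T] by (auto simp: F_def)
      then show "?s T = 0"
        using ball_average_constant_on[of u T x] by simp
    qed (use x in \<open>auto simp: F_def\<close>)
    also have "\<dots> = infsum ?s {T \<in> balls UNIV. B \<subseteq> T} + infsum ?s {T \<in> F. x \<in> T}"
      using finite_subset[OF _ fin, of "{T \<in> F. x \<in> T}"]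
      by (intro infsum_Un_disjoint sminus summable_on_finite) (auto simp: F_def)
    also have "infsum ?s {T \<in> F. x \<in> T} = (\<Sum>T\<in>F. indicator T x *\<^sub>R ?s T)"
      using fin by (auto simp: indicator_def intro!: sum.mono_neutral_cong_left)
    finally show ?thesis
      by (simp add: minus g_def)
  qed
  have iT: "set_integrable m B (\<lambda>x. indicator T x *\<^sub>R (of_real (C T) * (u x - ball_average m T u)))"
    and zT: "(LINT x:B|m. indicator T x *\<^sub>R (of_real (C T) * (u x - ball_average m T u))) = 0"
    if T: "T \<in> F" for T
  proof -
    have *: "indicat_real B x *\<^sub>R indicat_real T x *\<^sub>R (of_real (C T) * (u x - ball_average m T u))
        = indicat_real T x *\<^sub>R (of_real (C T) * (u x - ball_average m T u))" for x
      using T by (auto simp: F_def indicator_def)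
    have Tb: "T \<in> balls UNIV"
      using T by (simp add: F_def)
    have i: "set_integrable m T (\<lambda>x. u x - ball_average m T u)"
      by (intro set_integral_diff int Tb set_integrable_const_ball)
    show "set_integrable m B (\<lambda>x. indicator T x *\<^sub>R (of_real (C T) * (u x - ball_average m T u)))"
      using set_integrable_mult_right[of "of_real (C T)" m T "\<lambda>x. u x - ball_average m T u"] i
      unfolding set_integrable_def * by simp
    have "(LINT x:T|m. u x - ball_average m T u) = of_real (measure m T) * ball_average m T (\<lambda>x. u x - ball_average m T u)"
      using measure_ball_pos[OF Tb] by (simp add: ball_average_def)
    also have "\<dots> = 0"
      using Tb by (simp add: ball_average_diff int set_integrable_const_ball ball_average_const)
    finally show "(LINT x:B|m. indicator T x *\<^sub>R (of_real (C T) * (u x - ball_average m T u))) = 0"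
      unfolding set_lebesgue_integral_def * by (simp add: mult_scaleR_right[symmetric] del: mult_scaleR_right)
  qed
  have i1: "set_integrable m B (\<lambda>x. u x * \<Lambda> - c)"
    by (intro set_integral_diff set_integrable_mult_left int assms(3) set_integrable_const_ball)
  have i2: "set_integrable m B (\<lambda>x. \<Sum>T\<in>F. indicator T x *\<^sub>R (of_real (C T) * (u x - ball_average m T u)))"
    using iT unfolding set_integrable_def scaleR_sum_right by (rule Bochner_Integration.integrable_sum)
  have ig: "set_integrable m B g"
    unfolding g_def by (intro set_integral_add i1 i2)
  have "set_integrable m B (hierarchical_Laplacian m C u) \<longleftrightarrow> set_integrable m B g"
    using Lu by (intro set_integrable_cong) auto
  with ig show "set_integrable m B (hierarchical_Laplacian m C u)"
    by simp
  have "(LINT x:B|m. \<Sum>T\<in>F. indicator T x *\<^sub>R (of_real (C T) * (u x - ball_average m T u)))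
     = (\<Sum>T\<in>F. LINT x:B|m. indicator T x *\<^sub>R (of_real (C T) * (u x - ball_average m T u)))"
    using iT unfolding set_lebesgue_integral_def set_integrable_def scaleR_sum_right
    by (rule Bochner_Integration.integral_sum)
  also have "\<dots> = 0"
    by (simp add: zT)
  finally have "(LINT x:B|m. g x) = (LINT x:B|m. u x * \<Lambda> - c)"
    unfolding g_def by (simp only: set_integral_add(2)[OF i1 i2] add_0_right)
  then have "ball_average m B g = ball_average m B (\<lambda>x. u x * \<Lambda> - c)"
    by (simp add: ball_average_def)
  also have "\<dots> = ball_average m B (\<lambda>x. u x * \<Lambda>) - c"
    using assms(3) by (subst ball_average_diff)
      (auto intro!: set_integrable_mult_left int set_integrable_const_ball simp: ball_average_const)
  also have "ball_average m B (\<lambda>x. u x * \<Lambda>) = ball_average m B u * \<Lambda>"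
    by (simp add: ball_average_def)
  also have "ball_average m B u * \<Lambda> - c = averaged_Laplacian m C u B"
    unfolding averaged_Laplacian_def by (simp add: minus)
  finally show "ball_average m B (hierarchical_Laplacian m C u) = averaged_Laplacian m C u B"
    using ball_average_cong[OF Lu] by simp
qed

end

end

section \<open>The discrete space of horocycle balls\<close>

text \<open>
  The choice of points is encoded by the retraction \<open>\<pi>\<close> of the space onto \<open>X'\<close> rather than by a
  function of balls: the points of \<open>X'\<close> are \<open>range \<pi>\<close>, and functions on \<open>X'\<close> extend to the space by
  composition with \<open>\<pi>\<close>.
\<close>

locale horocycle_sampling = homogeneous_ultrametric_measure_space m
  for m :: "'a::metric_space measure" +
  fixes C :: "'a set \<Rightarrow> real" and \<rho> :: real and \<pi> :: "'a \<Rightarrow> 'a" and m' :: "'a measure"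
  assumes weight: "hierarchical_weight UNIV C"
    and \<rho>_pos: "\<rho> > 0"
    and \<pi>_mem: "\<pi> x \<in> cball x \<rho>"
    and \<pi>_cong: "cball x \<rho> = cball y \<rho> \<Longrightarrow> \<pi> x = \<pi> y"
    and space_m': "space m' = range \<pi>"
    and sets_m': "sets m' = Pow (range \<pi>)"
    and emeasure_m': "emeasure m' {\<pi> x} = emeasure m (cball x \<rho>)"
begin

abbreviation K :: "'a \<Rightarrow> 'a set" where "K x \<equiv> cball x \<rho>"

lemma K_ball: "K x \<in> balls UNIV"
  using \<rho>_pos by (rule cball_in_balls)

lemma mem_K: "x \<in> K x"
  using \<rho>_pos by simp

lemma K_\<pi>: "K (\<pi> x) = K x"
  using \<pi>_mem by (rule cball_eq_of_mem)

lemma \<pi>_eq_iff: "\<pi> x = \<pi> y \<longleftrightarrow> K x = K y"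
  using \<pi>_cong K_\<pi> by metis

lemma \<pi>_\<pi> [simp]: "\<pi> (\<pi> x) = \<pi> x"
  by (simp add: \<pi>_eq_iff K_\<pi>)

lemma \<pi>_eq_of_mem: "y \<in> K x \<Longrightarrow> \<pi> y = \<pi> x"
  by (simp add: \<pi>_eq_iff cball_eq_of_mem)

lemma vimage_\<pi>_single: "\<pi> -` {\<pi> x} = K x"
proof (intro set_eqI iffI)
  fix y assume "y \<in> \<pi> -` {\<pi> x}"
  then have "K y = K x"
    by (simp add: \<pi>_eq_iff)
  then show "y \<in> K x"
    using mem_K by blast
qed (simp add: \<pi>_eq_of_mem del: mem_cball)

lemma disjoint_K: "disjoint_family_on (\<lambda>B. B) (range K)"
  unfolding disjoint_family_on_def
proof clarify
  fix x y assume "K x \<noteq> K y"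
  then show "K x \<inter> K y = {}"
    using cball_eq_of_mem by (metis disjoint_iff)
qed

lemma K_Int_range: "K x \<inter> range \<pi> = {\<pi> x}"
proof (intro set_eqI iffI)
  fix y assume "y \<in> K x \<inter> range \<pi>"
  then show "y \<in> {\<pi> x}"
    using \<pi>_eq_of_mem[of y x] by (auto simp del: mem_cball)
qed (use \<pi>_mem in blast)

lemma open_vimage_\<pi>: "open (\<pi> -` S)"
proof (subst open_subopen, intro ballI)
  fix x assume "x \<in> \<pi> -` S"
  then show "\<exists>T. open T \<and> x \<in> T \<and> T \<subseteq> \<pi> -` S"
    using open_ball[OF K_ball] mem_K \<pi>_eq_of_mem by (intro exI[of _ "K x"]) (auto simp del: mem_cball)
qed

lemma measurable_\<pi> [measurable]: "\<pi> \<in> measurable m m'"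
  using open_vimage_\<pi> by (intro measurableI) (auto simp: space_m' sets_m' sets_m)

lemma borel_measurable_m': "f \<in> borel_measurable m'"
  for f :: "'a \<Rightarrow> 'b::topological_space"
  by (rule measurableI) (auto simp: space_m' sets_m')

lemma measurable_comp_\<pi> [measurable]: "(\<lambda>x. f (\<pi> x)) \<in> borel_measurable m"
  for f :: "'a \<Rightarrow> 'b::topological_space"
  using measurable_\<pi> borel_measurable_m' by (rule measurable_compose)

lemma countable_range_\<pi>: "countable (range \<pi>)"
proof -
  \<comment> \<open>Chosen points are indexed by their horocycle balls, which are countably many.\<close>
  have "\<pi> x = \<pi> (SOME z. z \<in> K x)" for x
    using \<pi>_eq_of_mem[of "SOME z. z \<in> K x" x] someI[of "\<lambda>z. z \<in> K x" x] mem_K by metis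
  then have "range \<pi> \<subseteq> (\<lambda>B. \<pi> (SOME z. z \<in> B)) ` range K"
    by blast
  then show ?thesis
    using countable_cballs[OF \<rho>_pos] by (meson countable_image countable_subset)
qed

text \<open>
  Both measures live on a countable set and agree on points. All integrals over \<open>X'\<close> become integrals
  over the original space in this way.
\<close>

lemma m'_eq_distr: "m' = distr m m' \<pi>"
proof (rule measure_eqI_countable)
  fix p assume "p \<in> range \<pi>"
  then obtain x where "p = \<pi> x" by blast
  then show "emeasure m' {p} = emeasure (distr m m' \<pi>) {p}"
    by (simp add: emeasure_m' emeasure_distr sets_m' vimage_\<pi>_single)
qed (simp_all add: sets_m' countable_range_\<pi>)

lemma integral_m': "integral\<^sup>L m' f = (LINT x|m. f (\<pi> x))"
  for f :: "'a \<Rightarrow> 'b::{banach, second_countable_topology}"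
  by (subst m'_eq_distr) (rule integral_distr[OF measurable_\<pi> borel_measurable_m'])

lemma integrable_m': "integrable m' f \<longleftrightarrow> integrable m (\<lambda>x. f (\<pi> x))"
  for f :: "'a \<Rightarrow> 'b::{banach, second_countable_topology}"
  by (subst m'_eq_distr) (rule integrable_distr_eq[OF measurable_\<pi> borel_measurable_m'])

lemma L2_m'_iff: "f \<in> L2 m' \<longleftrightarrow> f \<in> extensional (range \<pi>) \<and> (\<lambda>x. f (\<pi> x)) \<in> L2 m"
  by (simp add: L2_def space_m' borel_measurable_m' integrable_m' del: mem_cball)

lemma L2_dist_m': "L2_dist m' f g = L2_dist m (\<lambda>x. f (\<pi> x)) (\<lambda>x. g (\<pi> x))"
  by (simp add: L2_dist_def integral_m')

text \<open>
  A ball containing one horocycle ball is a union of horocycle balls.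
\<close>

lemma vimage_\<pi>_ball:
  assumes "T \<in> balls UNIV" "K x \<subseteq> T"
  shows "\<pi> -` (T \<inter> range \<pi>) = T"
proof -
  have K: "K y \<subseteq> T" if "y \<in> T" for y
  proof -
    have "K y \<subseteq> T \<or> T \<subseteq> K y"
      using that mem_K by (intro balls_nested[OF K_ball assms(1)])
    moreover have "K x = K y" if "T \<subseteq> K y"
      using that assms(2) mem_K by (intro cball_eq_of_mem) blast
    ultimately show ?thesis
      using assms(2) by blast
  qed
  show ?thesis
  proof (intro set_eqI iffI)
    fix y assume "y \<in> \<pi> -` (T \<inter> range \<pi>)"
    then show "y \<in> T"
      using K[of "\<pi> y"] K_\<pi> mem_K by blast
  next
    fix y assume "y \<in> T"
    then show "y \<in> \<pi> -` (T \<inter> range \<pi>)"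
      using K[of y] \<pi>_mem by blast
  qed
qed

text \<open>
  A ball of \<open>X'\<close> of radius less than \<open>\<rho>\<close> is a single point, hence also the trace of a horocycle ball.
\<close>

lemma balls_range_\<pi>: "balls (range \<pi>) = (\<lambda>T. T \<inter> range \<pi>) ` {T \<in> balls UNIV. \<exists>x. K x \<subseteq> T}"
proof (intro set_eqI iffI)
  fix S assume "S \<in> balls (range \<pi>)"
  then obtain x r where S: "r > 0" "S = cball (\<pi> x) r \<inter> range \<pi>"
    by (auto simp: balls_def)
  show "S \<in> (\<lambda>T. T \<inter> range \<pi>) ` {T \<in> balls UNIV. \<exists>x. K x \<subseteq> T}"
  proof (cases "\<rho> \<le> r")
    case True
    then have "K (\<pi> x) \<subseteq> cball (\<pi> x) r"
      by (rule subset_cball)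
    then show ?thesis
      using S cball_in_balls[OF S(1)] by blast
  next
    case False
    then have "cball (\<pi> x) r \<subseteq> K (\<pi> x)"
      by (intro subset_cball) simp
    then have "cball (\<pi> x) r \<inter> range \<pi> = K (\<pi> x) \<inter> range \<pi>"
      using \<pi>_eq_of_mem[of _ "\<pi> x"] S(1) by (auto simp del: mem_cball) (metis \<pi>_\<pi> centre_in_cball less_imp_le)
    then show ?thesis
      using S(2) K_ball[of "\<pi> x"] by blast
  qed
next
  fix S assume "S \<in> (\<lambda>T. T \<inter> range \<pi>) ` {T \<in> balls UNIV. \<exists>x. K x \<subseteq> T}"
  then obtain T x where T: "T \<in> balls UNIV" "K x \<subseteq> T" "S = T \<inter> range \<pi>"
    by blast
  then have "\<pi> x \<in> T"
    using \<pi>_mem by blast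
  with T(1) obtain r where "r > 0" "T = cball (\<pi> x) r"
    by (rule ball_cases)
  with T(3) show "S \<in> balls (range \<pi>)"
    by (auto simp: balls_def simp del: mem_cball)
qed

lemma bij_betw_balls_above:
  assumes "T0 \<in> balls UNIV" "K x \<subseteq> T0"
  shows "bij_betw (\<lambda>T. T \<inter> range \<pi>) {T \<in> balls UNIV. T0 \<subseteq> T}
    {S \<in> balls (range \<pi>). T0 \<inter> range \<pi> \<subseteq> S}"
proof (rule bij_betw_byWitness[where f' = "\<lambda>S. \<pi> -` S"])
  have "\<pi> -` S \<in> balls UNIV" "T0 \<subseteq> \<pi> -` S" "\<pi> -` S \<inter> range \<pi> = S"
    if S: "S \<in> balls (range \<pi>)" "T0 \<inter> range \<pi> \<subseteq> S" for S
  proof -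
    obtain T y where T: "T \<in> balls UNIV" "K y \<subseteq> T" "S = T \<inter> range \<pi>"
      using S(1) unfolding balls_range_\<pi> by blast
    then show "\<pi> -` S \<in> balls UNIV"
      using vimage_\<pi>_ball by metis
    show "\<pi> -` S \<inter> range \<pi> = S"
      using vimage_\<pi>_ball T by metis
    show "T0 \<subseteq> \<pi> -` S"
      using vimage_\<pi>_ball[OF assms] S(2) by blast
  qed
  then show "\<forall>S\<in>{S \<in> balls (range \<pi>). T0 \<inter> range \<pi> \<subseteq> S}. \<pi> -` S \<inter> range \<pi> = S"
    "(\<lambda>S. \<pi> -` S) ` {S \<in> balls (range \<pi>). T0 \<inter> range \<pi> \<subseteq> S} \<subseteq> {T \<in> balls UNIV. T0 \<subseteq> T}"
    by blast+
  show "\<forall>T\<in>{T \<in> balls UNIV. T0 \<subseteq> T}. \<pi> -` (T \<inter> range \<pi>) = T"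
    using vimage_\<pi>_ball assms by blast
  show "(\<lambda>T. T \<inter> range \<pi>) ` {T \<in> balls UNIV. T0 \<subseteq> T} \<subseteq> {S \<in> balls (range \<pi>). T0 \<inter> range \<pi> \<subseteq> S}"
    unfolding balls_range_\<pi> using assms by blast
qed

text \<open>
  By \<open>vimage_\<pi>_ball\<close> the preimage under \<open>\<pi>\<close> recovers a ball from its trace on \<open>X'\<close>.
\<close>

definition induced_weight :: "'a set \<Rightarrow> real" where
  "induced_weight S = C (\<pi> -` S)"

lemma hierarchical_weight_induced: "hierarchical_weight (range \<pi>) induced_weight"
  unfolding hierarchical_weight_def
proof (intro conjI ballI)
  fix S assume "S \<in> balls (range \<pi>)"
  then obtain T x where T: "T \<in> balls UNIV" "K x \<subseteq> T" "S = T \<inter> range \<pi>"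
    unfolding balls_range_\<pi> by blast
  show "induced_weight S > 0"
    unfolding induced_weight_def T(3) vimage_\<pi>_ball[OF T(1,2)]
    using T(1) weight by (simp add: hierarchical_weight_def)
  have "(\<lambda>T. induced_weight (T \<inter> range \<pi>)) summable_on {U \<in> balls UNIV. T \<subseteq> U} \<longleftrightarrow>
      C summable_on {U \<in> balls UNIV. T \<subseteq> U}"
  proof (rule summable_on_cong)
    fix U assume "U \<in> {U \<in> balls UNIV. T \<subseteq> U}"
    then have U: "U \<in> balls UNIV" "K x \<subseteq> U"
      using T(2) by auto
    show "induced_weight (U \<inter> range \<pi>) = C U"
      unfolding induced_weight_def vimage_\<pi>_ball[OF U] ..
  qed
  also have "\<dots>"
    using T(1) weight by (simp add: hierarchical_weight_def)
  finally show "induced_weight summable_on {U \<in> balls (range \<pi>). S \<subseteq> U}"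
    using summable_on_reindex_bij_betw[OF bij_betw_balls_above[OF T(1,2)], of induced_weight] T(3) by simp
qed

lemma ball_average_m':
  assumes "T \<in> balls UNIV" "K x \<subseteq> T"
  shows "ball_average m' (T \<inter> range \<pi>) f = ball_average m T (\<lambda>x. f (\<pi> x))"
proof -
  note v = vimage_\<pi>_ball[OF assms]
  have "indicat_real (T \<inter> range \<pi>) (\<pi> y) = indicator T y" for y
    using v by (auto simp: indicator_def)
  then have 1: "(LINT y:T \<inter> range \<pi>|m'. f y) = (LINT y:T|m. f (\<pi> y))"
    by (simp add: set_lebesgue_integral_def integral_m')
  have "measure m' (T \<inter> range \<pi>) = measure m (\<pi> -` (T \<inter> range \<pi>) \<inter> space m)"
    by (subst m'_eq_distr, rule measure_distr) (auto simp: sets_m')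
  then have "measure m' (T \<inter> range \<pi>) = measure m T"
    by (simp only: v space_m Int_UNIV_right)
  with 1 show ?thesis
    by (simp add: ball_average_def)
qed

lemma constant_on_K: "(\<lambda>x. f (\<pi> x)) constant_on K x"
  using \<pi>_eq_of_mem by (auto simp: constant_on_def simp del: mem_cball)

text \<open>
  The balls of \<open>X'\<close> containing a point correspond to the balls of the original space above its
  horocycle ball, with the same weights and the same means.
\<close>

lemma Laplacian_m':
  "hierarchical_Laplacian m' induced_weight f (\<pi> x) = averaged_Laplacian m C (\<lambda>x. f (\<pi> x)) (K x)"
proof -
  let ?s = "\<lambda>S. of_real (induced_weight S) * (f (\<pi> x) - ball_average m' S f)"
  have bij: "bij_betw (\<lambda>T. T \<inter> range \<pi>) {T \<in> balls UNIV. K x \<subseteq> T} {S \<in> balls (range \<pi>). \<pi> x \<in> S}"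
    using bij_betw_balls_above[OF K_ball order_refl, of x] by (simp add: K_Int_range)
  have "hierarchical_Laplacian m' induced_weight f (\<pi> x) = infsum ?s {S \<in> balls (range \<pi>). \<pi> x \<in> S}"
    by (simp add: hierarchical_Laplacian_def ball_average_def space_m')
  also have "\<dots> = (\<Sum>\<^sub>\<infinity>T\<in>{T \<in> balls UNIV. K x \<subseteq> T}. ?s (T \<inter> range \<pi>))"
    by (rule infsum_reindex_bij_betw[OF bij, symmetric])
  also have "\<dots> = averaged_Laplacian m C (\<lambda>x. f (\<pi> x)) (K x)"
    unfolding averaged_Laplacian_def
  proof (rule infsum_cong)
    fix T assume "T \<in> {T \<in> balls UNIV. K x \<subseteq> T}"
    then have T: "T \<in> balls UNIV" "K x \<subseteq> T" by auto
    show "?s (T \<inter> range \<pi>) = of_real (C T) *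
        (ball_average m (K x) (\<lambda>x. f (\<pi> x)) - ball_average m T (\<lambda>x. f (\<pi> x)))"
      using ball_average_constant_on[OF constant_on_K[of f x] K_ball mem_K]
      by (simp only: induced_weight_def vimage_\<pi>_ball[OF T] ball_average_m'[OF T])
  qed
  finally show ?thesis .
qed

lemma Laplacian_comp_\<pi>:
  "hierarchical_Laplacian m C (\<lambda>x. f (\<pi> x)) x = hierarchical_Laplacian m' induced_weight f (\<pi> x)"
  using Laplacian_eq_averaged_Laplacian[OF weight constant_on_K K_ball mem_K] Laplacian_m' by simp

section \<open>Averaging over horocycle balls\<close>

definition horocycle_average :: "('a \<Rightarrow> complex) \<Rightarrow> 'a \<Rightarrow> complex" where
  "horocycle_average f x = ball_average m (K x) f"

lemma horocycle_average_\<pi> [simp]: "horocycle_average f (\<pi> x) = horocycle_average f x"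
  by (simp add: horocycle_average_def K_\<pi>)

lemma horocycle_average_constant_on_K: "horocycle_average f constant_on K x"
  using constant_on_K[of "horocycle_average f" x] by simp

lemma horocycle_average_measurable [measurable]: "horocycle_average f \<in> borel_measurable m"
  using measurable_comp_\<pi>[of "horocycle_average f"] by simp

text \<open>
  Cauchy-Schwarz on each horocycle ball, summed over the countable partition. The sum is expressed by
  comparing the measures with densities \<open>|h|\<^sup>2\<close> on the pieces.
\<close>

lemma horocycle_average_contraction:
  assumes "f \<in> L2 m"
  shows "horocycle_average f \<in> L2 m"
    and "(LINT x|m. (cmod (horocycle_average f x))\<^sup>2) \<le> (LINT x|m. (cmod (f x))\<^sup>2)"
proof -
  have f[measurable]: "f \<in> borel_measurable m" and i: "integrable m (\<lambda>x. (cmod (f x))\<^sup>2)"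
    using assms by (auto simp: L2_iff)
  let ?N = "\<lambda>f. density m (\<lambda>x. ennreal ((cmod (f x))\<^sup>2))"
  have total: "(\<integral>\<^sup>+x. ennreal ((cmod (h x))\<^sup>2) \<partial>m) = (\<integral>\<^sup>+B. emeasure (?N h) B \<partial>count_space (range K))"
    if [measurable]: "h \<in> borel_measurable m" for h
  proof -
    have "(\<integral>\<^sup>+x. ennreal ((cmod (h x))\<^sup>2) \<partial>m) = emeasure (?N h) UNIV"
      using emeasure_density[of "\<lambda>x. ennreal ((cmod (h x))\<^sup>2)" m UNIV] sets.top[of m] by simp
    also have "UNIV = (\<Union>B\<in>range K. B)"
      using mem_K by (auto simp del: mem_cball)
    also have "emeasure (?N h) \<dots> = (\<integral>\<^sup>+B. emeasure (?N h) B \<partial>count_space (range K))"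
      using countable_cballs[OF \<rho>_pos] disjoint_K sets_ball[OF K_ball]
      by (intro emeasure_UN_countable) auto
    finally show ?thesis
      by simp
  qed
  have le: "emeasure (?N (horocycle_average f)) B \<le> emeasure (?N f) B" if "B \<in> range K" for B
  proof -
    from that obtain z where B: "B = K z"
      by (rule imageE)
    have [measurable]: "B \<in> sets m"
      using sets_ball[OF K_ball] B by simp
    have "emeasure (?N (horocycle_average f)) B
        = (\<integral>\<^sup>+x. ennreal ((cmod (horocycle_average f x))\<^sup>2) * indicator B x \<partial>m)"
      by (rule emeasure_density) measurable
    also have "\<dots> = (\<integral>\<^sup>+x. ennreal ((cmod (ball_average m B f))\<^sup>2) * indicator B x \<partial>m)"
      using cball_eq_of_mem
      by (intro nn_integral_cong) (auto simp: indicator_def horocycle_average_def B simp del: mem_cball)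
    also have "\<dots> = ennreal ((cmod (ball_average m B f))\<^sup>2) * emeasure m B"
      by (rule nn_integral_cmult_indicator) measurable
    also have "\<dots> \<le> (\<integral>\<^sup>+x\<in>B. ennreal ((cmod (f x))\<^sup>2) \<partial>m)"
      unfolding B by (rule ball_average_square_le[OF f K_ball])
    also have "\<dots> = emeasure (?N f) B"
      by (rule emeasure_density[symmetric]) measurable
    finally show ?thesis .
  qed
  have nn: "(\<integral>\<^sup>+x. ennreal ((cmod (horocycle_average f x))\<^sup>2) \<partial>m) \<le> (\<integral>\<^sup>+x. ennreal ((cmod (f x))\<^sup>2) \<partial>m)"
    unfolding total[OF f] total[OF horocycle_average_measurable]
    by (intro nn_integral_mono le) simp
  also have fin: "\<dots> = ennreal (LINT x|m. (cmod (f x))\<^sup>2)"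
    using i by (intro nn_integral_eq_integral) auto
  finally have nn': "(\<integral>\<^sup>+x. ennreal ((cmod (horocycle_average f x))\<^sup>2) \<partial>m)
      \<le> ennreal (LINT x|m. (cmod (f x))\<^sup>2)" .
  have i': "integrable m (\<lambda>x. (cmod (horocycle_average f x))\<^sup>2)"
    using le_less_trans[OF nn' ennreal_less_top] by (intro integrableI_bounded) (auto simp: top_unique)
  then show "horocycle_average f \<in> L2 m"
    by (simp add: L2_iff)
  have "ennreal (LINT x|m. (cmod (horocycle_average f x))\<^sup>2) \<le> ennreal (LINT x|m. (cmod (f x))\<^sup>2)"
    using nn' nn_integral_eq_integral[OF i'] by simp
  then show "(LINT x|m. (cmod (horocycle_average f x))\<^sup>2) \<le> (LINT x|m. (cmod (f x))\<^sup>2)"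
    by (subst (asm) ennreal_le_iff) auto
qed

lemma horocycle_average_diff:
  assumes "f \<in> L2 m" "g \<in> L2 m"
  shows "horocycle_average (\<lambda>x. f x - g x) = (\<lambda>x. horocycle_average f x - horocycle_average g x)"
  using assms by (auto simp: horocycle_average_def ball_average_diff L2_set_integrable_ball K_ball)

lemma L2_dist_horocycle_average_le:
  assumes "f \<in> L2 m" "g \<in> L2 m"
  shows "L2_dist m (horocycle_average f) (horocycle_average g) \<le> L2_dist m f g"
  using horocycle_average_contraction(2)[OF L2_diff[OF assms]] horocycle_average_diff[OF assms]
  by (simp add: L2_dist_def)

lemma horocycle_average_fixes:
  assumes "\<And>x. f constant_on K x"
  shows "horocycle_average f = f"
  using ball_average_constant_on[OF assms K_ball mem_K] by (auto simp: horocycle_average_def)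

text \<open>
  \<open>T\<close> is a finite disjoint union of horocycle balls, and on each of them the integral is unchanged.
\<close>

lemma ball_average_horocycle_average:
  assumes "f \<in> L2 m" "T \<in> balls UNIV" "K x \<subseteq> T"
  shows "ball_average m T (horocycle_average f) = ball_average m T f"
proof -
  define \<K> where "\<K> = {K y | y. y \<in> T}"
  have fin: "finite \<K>"
    unfolding \<K>_def by (rule finite_cballs_meeting_compact[OF compact_ball[OF assms(2)] \<rho>_pos])
  have T: "T = (\<Union>B\<in>\<K>. B)"
  proof (intro set_eqI iffI)
    fix y assume "y \<in> T"
    then show "y \<in> (\<Union>B\<in>\<K>. B)"
      using mem_K by (auto simp: \<K>_def simp del: mem_cball)
  next
    fix y assume "y \<in> (\<Union>B\<in>\<K>. B)"
    then obtain z where z: "z \<in> T" "y \<in> K z"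
      by (auto simp: \<K>_def simp del: mem_cball)
    then have "\<pi> y = \<pi> z"
      by (intro \<pi>_eq_of_mem)
    then show "y \<in> T"
      using z(1) vimage_\<pi>_ball[OF assms(2,3)] by (metis vimage_eq)
  qed
  have disj: "disjoint_family_on (\<lambda>B. B) \<K>"
    using disjoint_K by (rule disjoint_family_on_mono[rotated]) (auto simp: \<K>_def)
  have sets: "B \<in> balls UNIV" if "B \<in> \<K>" for B
    using that K_ball by (auto simp: \<K>_def)
  have LINT: "(LINT y:T|m. h y) = (\<Sum>B\<in>\<K>. of_real (measure m B) * ball_average m B h)"
    if "h \<in> L2 m" for h
  proof -
    have "(LINT y:T|m. h y) = (\<Sum>B\<in>\<K>. LINT y:B|m. h y)"
      using that sets sets_ball
      by (subst T, intro set_integral_finite_Union fin disj L2_set_integrable_ball) auto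
    also have "\<dots> = (\<Sum>B\<in>\<K>. of_real (measure m B) * ball_average m B h)"
    proof (intro sum.cong refl)
      fix B assume "B \<in> \<K>"
      then show "(LINT y:B|m. h y) = of_real (measure m B) * ball_average m B h"
        using measure_ball_pos[OF sets] by (simp add: ball_average_def less_imp_neq[symmetric])
    qed
    finally show ?thesis .
  qed
  have "ball_average m B (horocycle_average f) = ball_average m B f" if "B \<in> \<K>" for B
  proof -
    from that obtain y where "B = K y"
      unfolding \<K>_def by blast
    then show ?thesis
      using ball_average_constant_on[OF horocycle_average_constant_on_K[of f y] K_ball mem_K]
      by (simp add: horocycle_average_def)
  qed
  then show ?thesis
    using LINT[OF assms(1)] LINT[OF horocycle_average_contraction(1)[OF assms(1)]]
    by (simp add: ball_average_def[of m T])
qed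

text \<open>
  Only means over balls that are unions of horocycle balls enter.
\<close>

lemma averaged_Laplacian_horocycle_average:
  assumes "f \<in> L2 m"
  shows "averaged_Laplacian m C (horocycle_average f) (K x) = averaged_Laplacian m C f (K x)"
  unfolding averaged_Laplacian_def
  using ball_average_horocycle_average[OF assms, of _ x] ball_average_horocycle_average[OF assms K_ball order_refl]
  by (intro infsum_cong) simp

end

section \<open>Functions determined by their means over small balls\<close>

context homogeneous_ultrametric_measure_space
begin

text \<open>
  Every open set is a union of balls of the radii \<open>r/(n+1)\<close>, of which there are only countably many. As
  \<open>r\<close> is the largest radius, each of these balls is inside or disjoint from a given \<open>r\<close>-ball.
\<close>

lemma sets_m_generated_by_small_balls:
  assumes "r > 0"
  shows "sets m = sigma_sets UNIV (insert {} {cball x (r / real (Suc n)) | x n. True})"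
    (is "_ = sigma_sets UNIV ?G")
proof -
  let ?r = "\<lambda>n. r / real (Suc n)"
  have r: "?r n > 0" for n
    using assms by simp
  have "sets m = sigma_sets UNIV {S. open S}"
    by (simp add: sets_m borel_def)
  also have "\<dots> = sigma_sets UNIV ?G"
  proof (rule sigma_sets_eqI)
    fix S :: "'a set" assume "S \<in> {S. open S}"
    then have S: "open S" by simp
    have "countable (\<Union>n. range (\<lambda>x::'a. cball x (?r n)))"
      using countable_cballs[OF r] by (intro countable_UN) auto
    moreover have "{B \<in> ?G. B \<subseteq> S} \<subseteq> insert {} (\<Union>n. range (\<lambda>x::'a. cball x (?r n)))"
      by blast
    ultimately have "countable {B \<in> ?G. B \<subseteq> S}"
      by (meson countable_insert countable_subset)
    then have "\<Union>{B \<in> ?G. B \<subseteq> S} \<in> sigma_sets UNIV ?G"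
      by (rule sigma_sets_UNION) (auto intro: sigma_sets.Basic)
    moreover have "\<Union>{B \<in> ?G. B \<subseteq> S} = S"
    proof (intro set_eqI iffI)
      fix x assume "x \<in> S"
      then obtain e where e: "e > 0" "cball x e \<subseteq> S"
        using S open_contains_cball by blast
      obtain n where "r / e < real n"
        using reals_Archimedean2 by blast
      then have "?r n \<le> e"
        using e(1) assms by (simp add: field_simps)
      then have "cball x (?r n) \<in> {B \<in> ?G. B \<subseteq> S}"
        using e(2) by (blast dest: subset_cball[of _ _ x])
      moreover have "x \<in> cball x (?r n)"
        using r[of n] by simp
      ultimately show "x \<in> \<Union>{B \<in> ?G. B \<subseteq> S}"
        by blast
    qed blast
    ultimately show "S \<in> sigma_sets UNIV ?G"
      by simp
  next
    fix B assume "B \<in> ?G"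
    then have "open B"
      using open_ball[OF cball_in_balls[OF r]] by auto
    then show "B \<in> sigma_sets UNIV {S. open S}"
      by (simp add: sigma_sets.Basic)
  qed
  finally show ?thesis .
qed

lemma sigma_finite_m: "sigma_finite_measure m"
proof
  have "countable (range (\<lambda>x::'a. cball x 1))"
    by (rule countable_cballs) simp
  moreover have b: "cball x 1 \<in> balls UNIV" for x :: 'a
    by (rule cball_in_balls) simp
  moreover have "\<Union>(range (\<lambda>x::'a. cball x 1)) = space m"
    by force
  ultimately show "\<exists>A. countable A \<and> A \<subseteq> sets m \<and> \<Union>A = space m \<and> (\<forall>a\<in>A. emeasure m a \<noteq> \<infinity>)"
    using sets_ball[OF b] emeasure_ball[OF b]
    by (intro exI[of _ "range (\<lambda>x::'a. cball x 1)"]) auto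
qed

text \<open>
  Nested or disjoint balls, together with the empty set, are stable under intersection, so the integral
  vanishes over every Borel subset of \<open>K\<close> by the Dynkin argument.
\<close>

lemma AE_eq_0_of_ball_averages:
  assumes "r > 0" and K: "K = cball z r" and f: "set_integrable m K f"
    and avg: "\<And>B. B \<in> balls UNIV \<Longrightarrow> B \<subseteq> K \<Longrightarrow> ball_average m B f = 0"
  shows "AE x in m. x \<in> K \<longrightarrow> f x = 0"
proof -
  interpret sigma_finite_measure m
    by (rule sigma_finite_m)
  let ?G = "insert {} {cball x (r / real (Suc n)) | x n. True} :: 'a set set"
  define h where "h = (\<lambda>x. indicator K x *\<^sub>R f x)"
  have h: "integrable m h"
    using f by (simp add: h_def set_integrable_def)
  have hA: "set_integrable m A h" if "A \<in> sets m" for A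
    using h that unfolding set_integrable_def by (rule integrable_mult_indicator[rotated])
  have G: "B = {} \<or> B \<in> balls UNIV" if "B \<in> ?G" for B
    using that assms(1) by (auto intro!: cball_in_balls simp del: of_nat_Suc)
  have KB: "K \<in> balls UNIV"
    unfolding K using assms(1) by (rule cball_in_balls)
  have int0: "(LINT x:B|m. f x) = 0" if "B \<in> balls UNIV" "B \<subseteq> K" for B
    using avg[OF that] measure_ball_pos[OF that(1)] by (simp add: ball_average_def)
  have hf: "(LINT x:B|m. h x) = (LINT x:B \<inter> K|m. f x)" for B
    unfolding set_lebesgue_integral_def h_def
    by (intro Bochner_Integration.integral_cong) (auto simp: indicator_def)
  have stable: "Int_stable ?G"
  proof (rule Int_stableI)
    fix A B assume AB: "A \<in> ?G" "B \<in> ?G"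
    show "A \<inter> B \<in> ?G"
    proof (cases "A \<inter> B = {}")
      case False
      then have "A \<subseteq> B \<or> B \<subseteq> A"
        using G[OF AB(1)] G[OF AB(2)] balls_nested by blast
      then have "A \<inter> B = A \<or> A \<inter> B = B"
        by blast
      with AB show ?thesis
        by metis
    qed simp
  qed
  have Pow_UNIV_superset: "?G \<subseteq> Pow UNIV"
    by simp
  have total: "(LINT x:UNIV|m. h x) = 0"
    using hf[of UNIV] int0[OF KB] by simp
  have "(LINT x:A|m. h x) = 0" if "A \<in> sets m" for A
    using stable Pow_UNIV_superset that[unfolded sets_m_generated_by_small_balls[OF assms(1)]]
  proof (induction rule: sigma_sets_induct_disjoint)
    case (basic B)
    show ?case
    proof (cases "B \<inter> K = {}")
      case False
      then obtain x where x: "x \<in> B" "x \<in> K"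
        by blast
      with basic obtain y n where B: "B = cball y (r / real (Suc n))"
        by blast
      then have "B = cball x (r / real (Suc n))"
        using x(1) cball_eq_of_mem by metis
      also have "\<dots> \<subseteq> cball x r"
        using assms(1) by (intro subset_cball) (simp add: field_simps)
      also have "cball x r = K"
        using x(2) cball_eq_of_mem unfolding K by metis
      finally have "B \<subseteq> K" .
      then show ?thesis
        using hf[of B] int0[of B] G[OF basic] x(1) by (auto simp: Int_absorb2)
    qed (simp add: hf, simp add: set_lebesgue_integral_def)
  next
    case (compl A)
    then have A: "A \<in> sets m"
      by (simp add: sets_m_generated_by_small_balls[OF assms(1)])
    have "(LINT x:A \<union> (UNIV - A)|m. h x) = (LINT x:A|m. h x) + (LINT x:UNIV - A|m. h x)"
      using A sets.compl_sets[OF A] by (intro set_integral_Un hA) auto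
    then show ?case
      using total compl by simp
  next
    case (union A)
    then have A: "A i \<in> sets m" for i
      using union by (auto simp: sets_m_generated_by_small_balls[OF assms(1)])
    have "(LINT x:(\<Union>i. A i)|m. h x) = (\<Sum>i. LINT x:A i|m. h x)"
      using union(1) A by (intro lebesgue_integral_countable_add hA sets.countable_UN) (auto simp: disjoint_family_on_def)
    then show ?case
      using union by simp
  qed (auto simp: set_lebesgue_integral_def)
  then have "AE x in m. h x = 0"
    by (rule density_zero[OF h])
  then show ?thesis
    by eventually_elim (auto simp: h_def)
qed

end

context horocycle_sampling
begin

text \<open>
  Apply the previous lemma to \<open>g\<close> minus its mean on each of the countably many horocycle balls.
\<close>

lemma AE_eq_horocycle_average:
  assumes g: "g \<in> L2 m"
    and avg: "\<And>B x. B \<in> balls UNIV \<Longrightarrow> B \<subseteq> K x \<Longrightarrow> ball_average m B g = ball_average m (K x) g"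
  shows "AE x in m. g x = horocycle_average g x"
proof -
  have "AE x in m. x \<in> B \<longrightarrow> g x = horocycle_average g x" if "B \<in> range K" for B
  proof -
    from that obtain z where B: "B = K z"
      by (rule imageE)
    let ?c = "ball_average m B g"
    have i: "set_integrable m T g" "set_integrable m T (\<lambda>_. ?c)" if "T \<in> balls UNIV" for T
      using that g by (auto intro: L2_set_integrable_ball set_integrable_const_ball)
    have "AE x in m. x \<in> B \<longrightarrow> g x - ?c = 0"
    proof (rule AE_eq_0_of_ball_averages[OF \<rho>_pos B])
      show "set_integrable m B (\<lambda>x. g x - ?c)"
        using K_ball unfolding B by (intro set_integral_diff L2_set_integrable_ball set_integrable_const_ball g)
      show "ball_average m T (\<lambda>x. g x - ?c) = 0" if "T \<in> balls UNIV" "T \<subseteq> B" for T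
        unfolding ball_average_diff[OF i[OF that(1)]] ball_average_const[OF that(1)]
        using that avg[of T z] by (simp add: B)
    qed
    then show ?thesis
    proof eventually_elim
      case (elim x)
      show ?case
      proof
        assume "x \<in> B"
        then have "K x = B"
          unfolding B by (rule cball_eq_of_mem)
        then show "g x = horocycle_average g x"
          using elim \<open>x \<in> B\<close> by (simp add: horocycle_average_def)
      qed
    qed
  qed
  then have "AE x in m. \<forall>B\<in>range K. x \<in> B \<longrightarrow> g x = horocycle_average g x"
    using countable_cballs[OF \<rho>_pos] by (subst AE_ball_countable) auto
  then show ?thesis
    by eventually_elim (use mem_K in blast)
qed

section \<open>Transfer of test functions and the unitary map\<close>

text \<open>
  Points of \<open>X'\<close> lie in different horocycle balls, so \<open>X'\<close> is discrete and a compact subset meets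
  only finitely many of these balls.
\<close>

lemma test_functions_m'_iff:
  "f \<in> test_functions m' \<longleftrightarrow> f \<in> extensional (range \<pi>) \<and> finite {p \<in> range \<pi>. f p \<noteq> 0}"
proof -
  have loc: "\<exists>U. openin (top_of_set (range \<pi>)) U \<and> p \<in> U \<and> f constant_on U" if "p \<in> range \<pi>" for p
  proof -
    from that obtain x where p: "p = \<pi> x"
      by blast
    have "openin (top_of_set (range \<pi>)) (range \<pi> \<inter> K p)"
      using open_ball[OF K_ball] by (rule openin_open_Int)
    then have "openin (top_of_set (range \<pi>)) {p}"
      using K_Int_range[of "\<pi> x"] by (simp add: p Int_commute)
    then show ?thesis
      by (intro exI[of _ "{p}"]) (auto simp: constant_on_def)
  qed
  have fin: "finite S" if S: "compact (closure S \<inter> range \<pi>)" "S \<subseteq> range \<pi>" for S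
  proof (rule finite_subset)
    let ?D = "closure S \<inter> range \<pi>"
    show "S \<subseteq> ?D"
      using S(2) closure_subset by blast
    have "finite {K x | x. x \<in> ?D}"
      by (rule finite_cballs_meeting_compact[OF S(1) \<rho>_pos])
    moreover have "inj_on K ?D"
      by (rule inj_onI) (metis IntE imageE \<pi>_\<pi> \<pi>_cong)
    moreover have "{K x | x. x \<in> ?D} = K ` ?D"
      by blast
    ultimately show "finite ?D"
      by (metis finite_imageD)
  qed
  have "compact (closure {p \<in> range \<pi>. f p \<noteq> 0} \<inter> range \<pi>) \<longleftrightarrow> finite {p \<in> range \<pi>. f p \<noteq> 0}"
  proof
    show "finite {p \<in> range \<pi>. f p \<noteq> 0}" if "compact (closure {p \<in> range \<pi>. f p \<noteq> 0} \<inter> range \<pi>)"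
      using that by (rule fin) auto
    assume "finite {p \<in> range \<pi>. f p \<noteq> 0}"
    then show "compact (closure {p \<in> range \<pi>. f p \<noteq> 0} \<inter> range \<pi>)"
      by (simp add: finite_imp_closed finite_imp_compact)
  qed
  with loc show ?thesis
    by (auto simp: test_functions_def space_m')
qed

text \<open>
  The support of the extension is a finite union of horocycle balls, hence compact.
\<close>

lemma test_functions_comp_\<pi>:
  assumes "f \<in> test_functions m'"
  shows "(\<lambda>x. f (\<pi> x)) \<in> test_functions m"
proof -
  let ?S = "{x. f (\<pi> x) \<noteq> 0}"
  have fin: "finite {p \<in> range \<pi>. f p \<noteq> 0}"
    using assms by (simp add: test_functions_m'_iff)
  have "?S = (\<Union>p\<in>{p \<in> range \<pi>. f p \<noteq> 0}. K p)"
  proof (intro set_eqI iffI)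
    fix x assume "x \<in> ?S"
    then show "x \<in> (\<Union>p\<in>{p \<in> range \<pi>. f p \<noteq> 0}. K p)"
      using mem_K[of x] K_\<pi>[of x] by blast
  next
    fix x assume "x \<in> (\<Union>p\<in>{p \<in> range \<pi>. f p \<noteq> 0}. K p)"
    then obtain y where "f (\<pi> y) \<noteq> 0" "x \<in> K (\<pi> y)"
      by blast
    then show "x \<in> ?S"
      using \<pi>_eq_of_mem[of x "\<pi> y"] by simp
  qed
  then have "compact ?S"
    using fin compact_balls by (simp add: compact_UN)
  then have "compact (closure ?S)"
    by (simp add: compact_imp_closed)
  moreover have "\<exists>U. open U \<and> x \<in> U \<and> (\<lambda>x. f (\<pi> x)) constant_on U" for x
    using open_ball[OF K_ball] mem_K constant_on_K by blast
  ultimately show ?thesis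
    by (simp add: test_functions_def)
qed

text \<open>
  Unlike restriction to \<open>X'\<close>, which coincides with it on functions constant on horocycle balls, this map
  is continuous on all of \<open>L\<^sup>2\<close>.
\<close>

definition sample_average :: "('a \<Rightarrow> complex) \<Rightarrow> 'a \<Rightarrow> complex" where
  "sample_average f = restrict (horocycle_average f) (range \<pi>)"

lemma sample_average_\<pi> [simp]: "sample_average f (\<pi> x) = horocycle_average f x"
  by (simp add: sample_average_def)

lemma sample_average_test_function:
  assumes "u \<in> test_functions m"
  shows "sample_average u \<in> test_functions m'"
proof -
  let ?S = "closure {x. u x \<noteq> 0}"
  have "finite {K x | x. x \<in> ?S}"
    using assms \<rho>_pos by (intro finite_cballs_meeting_compact) (simp add: test_functions_def)
  moreover have "K ` {p \<in> range \<pi>. sample_average u p \<noteq> 0} \<subseteq> {K x | x. x \<in> ?S}"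
  proof clarify
    fix x assume "sample_average u (\<pi> x) \<noteq> 0"
    then have ne: "ball_average m (K x) u \<noteq> 0"
      by (simp add: horocycle_average_def)
    have "\<exists>y\<in>K x. u y \<noteq> 0"
    proof (rule ccontr)
      assume "\<not> ?thesis"
      then have "ball_average m (K x) u = ball_average m (K x) (\<lambda>_. 0)"
        by (intro ball_average_cong) auto
      with ne show False
        by (simp add: ball_average_const[OF K_ball])
    qed
    then obtain y where "y \<in> K x" "u y \<noteq> 0"
      by blast
    then have "K (\<pi> x) = K y" "y \<in> ?S"
      using cball_eq_of_mem[of y x \<rho>] K_\<pi>[of x] closure_subset[of "{x. u x \<noteq> 0}"] by auto
    then show "\<exists>y. K (\<pi> x) = K y \<and> y \<in> ?S"
      by blast
  qed
  ultimately have "finite (K ` {p \<in> range \<pi>. sample_average u p \<noteq> 0})"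
    by (rule rev_finite_subset)
  moreover have "inj_on K {p \<in> range \<pi>. sample_average u p \<noteq> 0}"
    by (rule inj_onI) (metis (mono_tags, lifting) imageE mem_Collect_eq \<pi>_\<pi> \<pi>_cong)
  ultimately have "finite {p \<in> range \<pi>. sample_average u p \<noteq> 0}"
    by (rule finite_imageD)
  then show ?thesis
    by (simp add: test_functions_m'_iff sample_average_def)
qed

lemma sample_average_L2: "f \<in> L2 m \<Longrightarrow> sample_average f \<in> L2 m'"
  using horocycle_average_contraction(1)[of f] by (simp add: L2_m'_iff) (simp add: sample_average_def)

lemma L2_dist_sample_average_le:
  "f \<in> L2 m \<Longrightarrow> g \<in> L2 m \<Longrightarrow> L2_dist m' (sample_average f) (sample_average g) \<le> L2_dist m f g"
  using L2_dist_horocycle_average_le by (simp add: L2_dist_m')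

lemma L_plus_iff: "f \<in> L_plus m (range K) \<longleftrightarrow> f \<in> L2 m \<and> (\<forall>x. f constant_on K x)"
  by (auto simp: L_plus_def simp del: mem_cball)

lemma L_plus_comp_\<pi>:
  assumes "f \<in> L_plus m (range K)"
  shows "f (\<pi> x) = f x"
  using assms \<pi>_mem[of x] mem_K[of x] unfolding L_plus_iff constant_on_def by metis

lemma sample_average_L_plus:
  assumes "f \<in> L_plus m (range K)"
  shows "sample_average f = restrict f (range \<pi>)"
  using assms by (simp add: sample_average_def horocycle_average_fixes L_plus_iff)

lemma comp_\<pi>_in_L_plus:
  assumes "f \<in> L2 m'"
  shows "(\<lambda>x. f (\<pi> x)) \<in> L_plus m (range K)"
  using assms constant_on_K unfolding L_plus_iff L2_m'_iff by blast

lemma restrict_comp_\<pi>: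
  assumes "f \<in> extensional (range \<pi>)"
  shows "restrict (\<lambda>x. f (\<pi> x)) (range \<pi>) = f"
  using assms by (auto simp: restrict_def extensional_def fun_eq_iff)

lemma restrict_in_L2_m':
  assumes "f \<in> L_plus m (range K)"
  shows "restrict f (range \<pi>) \<in> L2 m'"
  using assms L_plus_comp_\<pi>[OF assms] by (simp add: L2_m'_iff L_plus_iff)

lemma unitary_restrict:
  "unitary_between m (L_plus m (range K)) m' (L2 m') (\<lambda>f. restrict f (range \<pi>))"
  unfolding unitary_between_def
proof (intro conjI ballI allI)
  show "bij_betw (\<lambda>f. restrict f (range \<pi>)) (L_plus m (range K)) (L2 m')"
  proof (rule bij_betw_byWitness[where f' = "\<lambda>f x. f (\<pi> x)"])
    show "\<forall>f\<in>L_plus m (range K). (\<lambda>x. restrict f (range \<pi>) (\<pi> x)) = f"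
      using L_plus_comp_\<pi> by auto
    show "\<forall>f\<in>L2 m'. restrict (\<lambda>x. f (\<pi> x)) (range \<pi>) = f"
      by (intro ballI restrict_comp_\<pi>) (simp add: L2_m'_iff)
  qed (use restrict_in_L2_m' comp_\<pi>_in_L_plus in blast)+
next
  fix f g c
  show "restrict (\<lambda>x\<in>space m. c * f x + g x) (range \<pi>)
      = (\<lambda>y\<in>space m'. c * restrict f (range \<pi>) y + restrict g (range \<pi>) y)"
    by (auto simp: space_m')
next
  fix f g assume f: "f \<in> L_plus m (range K)" and g: "g \<in> L_plus m (range K)"
  show "L2_inner m' (restrict f (range \<pi>)) (restrict g (range \<pi>)) = L2_inner m f g"
    using L_plus_comp_\<pi>[OF f] L_plus_comp_\<pi>[OF g] by (simp add: L2_inner_def integral_m')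
qed

section \<open>The operators with a potential constant on horocycle balls\<close>

context
  fixes W :: "'a \<Rightarrow> real"
  assumes W: "\<And>x. W constant_on K x"
begin

abbreviation "H \<equiv> add_potential m (hierarchical_Laplacian m C) W"
abbreviation "H' \<equiv> add_potential m' (hierarchical_Laplacian m' induced_weight) W"

lemma W_eq_of_mem: "y \<in> K x \<Longrightarrow> W y = W x"
  using W[of x] mem_K[of x] unfolding constant_on_def by metis

lemma W_\<pi> [simp]: "W (\<pi> x) = W x"
  using \<pi>_mem by (rule W_eq_of_mem)

lemma H_comp_\<pi>: "H (\<lambda>x. f (\<pi> x)) x = H' f (\<pi> x)"
  by (simp add: add_potential_def space_m' Laplacian_comp_\<pi>)

lemma ball_average_H:
  assumes "u \<in> test_functions m" "u \<in> L2 m" "B \<in> balls UNIV" "B \<subseteq> K x"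
  shows "ball_average m B (H u) = averaged_Laplacian m C u B + of_real (W x) * ball_average m B u"
proof -
  have "ball_average m B (H u) = ball_average m B (\<lambda>y. hierarchical_Laplacian m C u y - (- of_real (W x)) * u y)"
    using assms(4) W_eq_of_mem by (intro ball_average_cong) (auto simp: add_potential_def)
  also have "\<dots> = ball_average m B (hierarchical_Laplacian m C u) - ball_average m B (\<lambda>y. (- of_real (W x)) * u y)"
    using assms by (intro ball_average_diff ball_average_Laplacian[OF weight] set_integrable_mult_right L2_set_integrable_ball)
  also have "ball_average m B (\<lambda>y. (- of_real (W x)) * u y) = - of_real (W x) * ball_average m B u"
    unfolding ball_average_def by (subst set_integral_mult_right) simp
  finally show ?thesis
    using ball_average_Laplacian(2)[OF weight assms(1-3)] by simp
qed

text \<open>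
  The intertwining relation: at a point of \<open>X'\<close> both sides are the mean of \<open>H u\<close> over the horocycle ball.
\<close>

lemma H'_sample_average:
  assumes "u \<in> test_functions m" "u \<in> L2 m"
  shows "H' (sample_average u) = sample_average (H u)"
proof
  fix p
  show "H' (sample_average u) p = sample_average (H u) p"
  proof (cases "p \<in> range \<pi>")
    case True
    then obtain x where p: "p = \<pi> x"
      by blast
    have "H' (sample_average u) p
      = averaged_Laplacian m C (horocycle_average u) (K x) + of_real (W x) * horocycle_average u x"
      by (simp add: p add_potential_def space_m' Laplacian_m')
    also have "\<dots> = averaged_Laplacian m C u (K x) + of_real (W x) * ball_average m (K x) u"
      using averaged_Laplacian_horocycle_average[OF assms(2)] by (simp add: horocycle_average_def)
    also have "\<dots> = sample_average (H u) p"
      using ball_average_H[OF assms K_ball order_refl] by (simp add: p horocycle_average_def)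
    finally show ?thesis .
  next
    case False
    then show ?thesis
      by (simp add: add_potential_def space_m' sample_average_def)
  qed
qed

text \<open>
  The formula for the means of \<open>H u\<close> is \<open>L\<^sup>2\<close>-continuous in \<open>u\<close> and hence holds for \<open>(f, g)\<close> in the closed
  graph. For \<open>f\<close> constant on a horocycle ball it gives the same mean of \<open>g\<close> on all balls inside.
\<close>

lemma invariant_L_plus: "invariant_subspace m (closure_graph m H) (L_plus m (range K))"
  unfolding invariant_subspace_def
proof clarify
  fix f g assume "(f, g) \<in> closure_graph m H" and f: "f \<in> L_plus m (range K)"
  then obtain u where fg: "f \<in> L2 m" "g \<in> L2 m"
    and u: "\<And>n. u n \<in> test_functions m" "\<And>n. u n \<in> L2 m" "\<And>n. H (u n) \<in> L2 m"
    and lim: "(\<lambda>n. L2_dist m (u n) f) \<longlonglongrightarrow> 0" "(\<lambda>n. L2_dist m (H (u n)) g) \<longlonglongrightarrow> 0"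
    by (auto simp: closure_graph_def)
  have avg: "ball_average m B g = averaged_Laplacian m C f B + of_real (W x) * ball_average m B f"
    if B: "B \<in> balls UNIV" "B \<subseteq> K x" for B x
  proof (rule LIMSEQ_unique)
    show "(\<lambda>n. ball_average m B (H (u n))) \<longlonglongrightarrow> ball_average m B g"
      using u(3) fg(2) lim(2) B(1) by (rule ball_average_tendsto)
    show "(\<lambda>n. ball_average m B (H (u n))) \<longlonglongrightarrow> averaged_Laplacian m C f B + of_real (W x) * ball_average m B f"
      unfolding ball_average_H[OF u(1,2) B]
      by (intro tendsto_add tendsto_mult tendsto_const
          averaged_Laplacian_tendsto[OF weight u(2) fg(1) lim(1) B(1)] ball_average_tendsto[OF u(2) fg(1) lim(1) B(1)])
  qed
  have const: "f constant_on K x" for x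
    using f by (simp add: L_plus_iff)
  have "AE x in m. g x = horocycle_average g x"
  proof (rule AE_eq_horocycle_average[OF fg(2)])
    fix B x assume B: "B \<in> balls UNIV" "B \<subseteq> K x"
    obtain y where y: "y \<in> B"
      using balls_nonempty[OF B(1)] by blast
    have cB: "f constant_on B"
      using constant_on_subset[OF const B(2)] .
    have "ball_average m B f = ball_average m (K x) f"
      using ball_average_constant_on[OF cB B(1) y] ball_average_constant_on[OF const K_ball, of y x] y B(2) by auto
    moreover have "averaged_Laplacian m C f B = averaged_Laplacian m C f (K x)"
      using Laplacian_eq_averaged_Laplacian[OF weight cB B(1) y]
        Laplacian_eq_averaged_Laplacian[OF weight const K_ball, of y x] y B(2) by auto
    ultimately show "ball_average m B g = ball_average m (K x) g"
      using avg[OF B] avg[OF K_ball order_refl, of x] by simp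
  qed
  moreover have "horocycle_average g \<in> L_plus m (range K)"
    using horocycle_average_contraction(1)[OF fg(2)] horocycle_average_constant_on_K by (simp add: L_plus_iff)
  ultimately show "\<exists>h\<in>L_plus m (range K). AE x in m. g x = h x"
    by blast
qed

text \<open>
  One inclusion replaces an approximating sequence \<open>u\<close> by its averages, the other composes an
  approximating sequence on \<open>X'\<close> with \<open>\<pi>\<close>.
\<close>

lemma conjugate_restriction_eq:
  "conjugate_graph (\<lambda>f. restrict f (range \<pi>)) (restriction_graph (closure_graph m H) (L_plus m (range K)))
    = closure_graph m' H'"
proof (intro equalityI subsetI)
  fix fg' assume "fg' \<in> conjugate_graph (\<lambda>f. restrict f (range \<pi>))
      (restriction_graph (closure_graph m H) (L_plus m (range K)))"
  then obtain f g where fg': "fg' = (restrict f (range \<pi>), restrict g (range \<pi>))"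
    and plus: "f \<in> L_plus m (range K)" "g \<in> L_plus m (range K)" and "(f, g) \<in> closure_graph m H"
    by (auto simp: conjugate_graph_def restriction_graph_def)
  then obtain u where fg: "f \<in> L2 m" "g \<in> L2 m"
    and u: "\<And>n. u n \<in> test_functions m" "\<And>n. u n \<in> L2 m" "\<And>n. H (u n) \<in> L2 m"
    and lim: "(\<lambda>n. L2_dist m (u n) f) \<longlonglongrightarrow> 0" "(\<lambda>n. L2_dist m (H (u n)) g) \<longlonglongrightarrow> 0"
    by (auto simp: closure_graph_def)
  have contract: "(\<lambda>n. L2_dist m' (sample_average (v n)) (restrict h (range \<pi>))) \<longlonglongrightarrow> 0"
    if "\<And>n. v n \<in> L2 m" "h \<in> L_plus m (range K)" "(\<lambda>n. L2_dist m (v n) h) \<longlonglongrightarrow> 0" for v h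
  proof (rule tendsto_sandwich[OF _ _ tendsto_const that(3)])
    show "\<forall>\<^sub>F n in sequentially. 0 \<le> L2_dist m' (sample_average (v n)) (restrict h (range \<pi>))"
      by (simp add: L2_dist_def)
    have "h \<in> L2 m"
      using that(2) by (simp add: L_plus_iff)
    then show "\<forall>\<^sub>F n in sequentially. L2_dist m' (sample_average (v n)) (restrict h (range \<pi>)) \<le> L2_dist m (v n) h"
      using L2_dist_sample_average_le[OF that(1)] by (simp add: flip: sample_average_L_plus[OF that(2)])
  qed
  show "fg' \<in> closure_graph m' H'"
    unfolding closure_graph_def fg'
  proof (clarify, intro conjI exI[of _ "\<lambda>n. sample_average (u n)"] allI)
    show "restrict f (range \<pi>) \<in> L2 m'" "restrict g (range \<pi>) \<in> L2 m'"
      using plus restrict_in_L2_m' by auto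
    fix n
    show "sample_average (u n) \<in> test_functions m'"
      using u(1) by (rule sample_average_test_function)
    show "sample_average (u n) \<in> L2 m'"
      using u(2) by (rule sample_average_L2)
    show "H' (sample_average (u n)) \<in> L2 m'"
      using u sample_average_L2 by (simp add: H'_sample_average)
  next
    show "(\<lambda>n. L2_dist m' (sample_average (u n)) (restrict f (range \<pi>))) \<longlonglongrightarrow> 0"
      using u(2) plus(1) lim(1) by (rule contract)
    show "(\<lambda>n. L2_dist m' (H' (sample_average (u n))) (restrict g (range \<pi>))) \<longlonglongrightarrow> 0"
      using contract[OF u(3) plus(2) lim(2)] u by (simp add: H'_sample_average)
  qed
next
  fix fg' assume "fg' \<in> closure_graph m' H'"
  then obtain f g u where fg': "fg' = (f, g)" and fg: "f \<in> L2 m'" "g \<in> L2 m'"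
    and u: "\<And>n. u n \<in> test_functions m'" "\<And>n. u n \<in> L2 m'" "\<And>n. H' (u n) \<in> L2 m'"
    and lim: "(\<lambda>n. L2_dist m' (u n) f) \<longlonglongrightarrow> 0" "(\<lambda>n. L2_dist m' (H' (u n)) g) \<longlonglongrightarrow> 0"
    by (auto simp: closure_graph_def)
  have Hu: "H (\<lambda>x. u n (\<pi> x)) = (\<lambda>x. H' (u n) (\<pi> x))" for n
    using H_comp_\<pi> by blast
  have "((\<lambda>x. f (\<pi> x)), (\<lambda>x. g (\<pi> x))) \<in> closure_graph m H"
    unfolding closure_graph_def
  proof (clarify, intro conjI exI[of _ "\<lambda>n x. u n (\<pi> x)"] allI)
    show "(\<lambda>x. f (\<pi> x)) \<in> L2 m" "(\<lambda>x. g (\<pi> x)) \<in> L2 m"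
      using fg by (simp_all add: L2_m'_iff)
    fix n
    show "(\<lambda>x. u n (\<pi> x)) \<in> test_functions m"
      using u(1) by (rule test_functions_comp_\<pi>)
    show "(\<lambda>x. u n (\<pi> x)) \<in> L2 m" "H (\<lambda>x. u n (\<pi> x)) \<in> L2 m"
      using u(2,3)[of n] by (simp_all add: L2_m'_iff Hu)
  next
    show "(\<lambda>n. L2_dist m (\<lambda>x. u n (\<pi> x)) (\<lambda>x. f (\<pi> x))) \<longlonglongrightarrow> 0"
      "(\<lambda>n. L2_dist m (H (\<lambda>x. u n (\<pi> x))) (\<lambda>x. g (\<pi> x))) \<longlonglongrightarrow> 0"
      using lim by (simp_all add: L2_dist_m' Hu)
  qed
  then have "((\<lambda>x. f (\<pi> x)), (\<lambda>x. g (\<pi> x))) \<in> restriction_graph (closure_graph m H) (L_plus m (range K))"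
    using fg comp_\<pi>_in_L_plus by (simp add: restriction_graph_def)
  moreover have "fg' = (restrict (\<lambda>x. f (\<pi> x)) (range \<pi>), restrict (\<lambda>x. g (\<pi> x)) (range \<pi>))"
    using fg restrict_comp_\<pi>[of f] restrict_comp_\<pi>[of g] unfolding fg' L2_m'_iff by simp
  ultimately show "fg' \<in> conjugate_graph (\<lambda>f. restrict f (range \<pi>))
      (restriction_graph (closure_graph m H) (L_plus m (range K)))"
    by (auto simp: conjugate_graph_def)
qed

end

end

section \<open>Identification of the restricted operators\<close>

lemma add_potential_0: "add_potential m (hierarchical_Laplacian m C) (\<lambda>_. 0) = hierarchical_Laplacian m C"
  by (intro ext) (simp add: add_potential_def hierarchical_Laplacian_def)

lemma add_potential_cong:
  "(\<And>x. x \<in> space m \<Longrightarrow> V x = W x) \<Longrightarrow> add_potential m A V = add_potential m A W"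
  by (auto simp: add_potential_def fun_eq_iff restrict_def)

lemma infsum_single_nonzero:
  assumes "b \<in> A" "\<And>x. x \<in> A \<Longrightarrow> x \<noteq> b \<Longrightarrow> f x = 0"
  shows "infsum f A = (f b :: real)"
proof -
  have "infsum f A = infsum f {b}"
    using assms by (intro infsum_cong_neutral) auto
  then show ?thesis
    by simp
qed

theorem lemma3p5:
  fixes m :: "'a::metric_space measure" and C :: "'a set \<Rightarrow> real"
    and \<H> :: "'a set set" and \<sigma> :: "'a set \<Rightarrow> real" and V :: "'a \<Rightarrow> real"
    and a :: "'a set \<Rightarrow> 'a" and m' :: "'a measure" and V' :: "'a \<Rightarrow> real"
    and L H :: "(('a \<Rightarrow> complex) \<times> ('a \<Rightarrow> complex)) set"
    and U :: "('a \<Rightarrow> complex) \<Rightarrow> 'a \<Rightarrow> complex"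
  assumes "homogeneous_ultrametric_measure_space m"
    and "hierarchical_weight UNIV C" and "homogeneous_weight UNIV C"
    and "horocycle UNIV \<H>"
    and V_def: "V = (\<lambda>x. \<Sum>\<^sub>\<infinity>B\<in>\<H>. \<sigma> B * indicator B x)"
    and L_def: "L = closure_graph m (hierarchical_Laplacian m C)"
    and H_def: "H = closure_graph m (add_potential m (hierarchical_Laplacian m C) V)"
    and "\<And>B. B \<in> \<H> \<Longrightarrow> a B \<in> B"
    and "space m' = a ` \<H>" and "sets m' = Pow (a ` \<H>)"
    and "\<And>B. B \<in> \<H> \<Longrightarrow> emeasure m' {a B} = emeasure m B"
    and V'_def: "V' = (\<lambda>x. \<Sum>\<^sub>\<infinity>b\<in>a ` \<H>. V b * indicator {b} x)"
    and U_def: "U = (\<lambda>f. restrict f (a ` \<H>))"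
  shows "invariant_subspace m L (L_plus m \<H>) \<and>
    invariant_subspace m H (L_plus m \<H>) \<and>
    unitary_between m (L_plus m \<H>) m' (L2 m') U \<and>
    (\<exists>C'. hierarchical_weight (a ` \<H>) C' \<and>
      conjugate_graph U (restriction_graph L (L_plus m \<H>))
        = closure_graph m' (hierarchical_Laplacian m' C') \<and>
      conjugate_graph U (restriction_graph H (L_plus m \<H>))
        = closure_graph m' (add_potential m' (hierarchical_Laplacian m' C') V'))"
proof -
  interpret homogeneous_ultrametric_measure_space m
    by fact
  obtain \<rho> where \<rho>: "\<rho> > 0" "\<H> = range (\<lambda>x. cball x \<rho>)"
    using horocycle_eq_cballs[OF assms(4)] by metis
  define \<pi> where "\<pi> = (\<lambda>x. a (cball x \<rho>))"
  have range: "a ` \<H> = range \<pi>"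
    by (auto simp: \<rho>(2) \<pi>_def)
  interpret horocycle_sampling m C \<rho> \<pi> m'
  proof unfold_locales
    show "\<pi> x \<in> cball x \<rho>" for x
      using assms(8) by (simp add: \<pi>_def \<rho>(2) del: mem_cball)
    show "emeasure m' {\<pi> x} = emeasure m (cball x \<rho>)" for x
      using assms(11) by (simp add: \<pi>_def \<rho>(2))
  qed (use assms \<rho>(1) range in \<open>simp_all add: \<pi>_def\<close>)
  have V: "V x = \<sigma> (cball x \<rho>)" for x
  proof -
    have "V x = \<sigma> (cball x \<rho>) * indicator (cball x \<rho>) x"
      unfolding V_def
    proof (rule infsum_single_nonzero)
      fix B assume "B \<in> \<H>" "B \<noteq> cball x \<rho>"
      then have "x \<notin> B"
        using cball_eq_of_mem by (auto simp: \<rho>(2) simp del: mem_cball)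
      then show "\<sigma> B * indicator B x = 0"
        by simp
    qed (simp add: \<rho>(2))
    then show ?thesis
      using mem_K[of x] by simp
  qed
  have V_const: "V constant_on cball x \<rho>" for x
    unfolding constant_on_def V using cball_eq_of_mem by metis
  have V': "V' b = V b" if "b \<in> space m'" for b
  proof -
    have "V' b = V b * indicator {b} b"
      unfolding V'_def using that by (intro infsum_single_nonzero) (auto simp: assms(9))
    then show ?thesis
      by simp
  qed
  have 0: "(\<lambda>_. 0 :: real) constant_on cball x \<rho>" for x :: 'a
    by (simp add: constant_on_def)
  show ?thesis
    unfolding L_def H_def U_def range unfolding \<rho>(2)
    using invariant_L_plus[OF V_const] invariant_L_plus[OF 0] unitary_restrict
      hierarchical_weight_induced conjugate_restriction_eq[OF V_const] conjugate_restriction_eq[OF 0]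
      add_potential_cong[of m' V' V, OF V']
    by (auto simp: add_potential_0)
qed

end
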